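(* Let $\mathcal{X}$ be a finite set, $p_X\in\mathscr{P}(\mathcal{X})$, and $\mathbf{g}:\mathscr{P}(\mathcal{X})\to\mathbb{R}^d$ twice continuously differentiable. Let $g_t'(x):=\partial g_t(q_X)/\partial q_X(x)|_{q_X=p_X}$ for $t=1,\dots,d$, $\mathbf{g}'(x):=(g_1'(x),\dots,g_d'(x))^T$, and for $X\sim p_X$ let $\mathbf{V}:=\mathrm{Cov}(\mathbf{g}'(X))$. Assume $\mathrm{rank}(\mathbf{V})\ge1$ and $\xi:=\mathsf{E}[\|\mathbf{g}'(X)-\mathsf{E}\mathbf{g}'(X)\|_2^3]<\infty$. Let $\kappa:=\max_{1\le t\le d}\|\nabla^2_{p_X}g_t(p_X)\|_2$ (spectral norm of the Hessian) and $b_n:=(\kappa+1)\log n/n$. Let $X^n=(X_1,\dots,X_n)$ be i.i.d. with law $p_X$ and $P_{X^n}$ its type. Then for any fixed $\mathbf{z}\in\mathbb{R}^d$, $$\mathsf{P}\Big(\mathbf{g}(P_{X^n})\ge\mathbf{g}(p_X)+\frac{\mathbf{z}}{\sqrt n}-b_n\mathbf{1}\Big)\ge\mathsf{P}(\mathbf{Z}\ge\mathbf{z})+O\Big(\frac{\log n}{\sqrt n}\Big),$$ where $\mathbf{Z}\sim\mathcal{N}(\mathbf{0},\mathbf{V})$.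
   Context: $\mathscr{P}(\mathcal{X})$ is the probability simplex on the finite set $\mathcal{X}$, viewed as a subset of $\mathbb{R}^{|\mathcal{X}|}$. The type of $x^n$ is the empirical distribution $P_{x^n}(a):=\frac1n|\{k:x_k=a\}|$. Vector inequalities are componentwise, $\mathbf{1}$ is the all-ones vector, logarithms are base 2. $O(\log n/\sqrt n)$ denotes a term bounded in absolute value by $C\log n/\sqrt n$ for some constant $C$ independent of $n$. *)

theory Defs
  imports "HOL-Probability.Probability"
begin

definition prob_simplex :: "(real^'a::finite) set" where
  "prob_simplex = {q. (\<forall>x. 0 \<le> q $ x) \<and> (\<Sum>x\<in>UNIV. q $ x) = 1}"

definition type_of :: "'a::finite list \<Rightarrow> real^'a" where
  "type_of xs = (\<chi> a. real (count_list xs a) / real (length xs))"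

definition iid_prob :: "real^'a::finite \<Rightarrow> nat \<Rightarrow> ('a list \<Rightarrow> bool) \<Rightarrow> real" where
  "iid_prob p n E = (\<Sum>xs\<in>{xs. length xs = n \<and> E xs}. \<Prod>i<n. p $ (xs ! i))"

definition outer :: "real^'d \<Rightarrow> real^'d^'d" where
  "outer v = (\<chi> i j. v $ i * v $ j)"

definition std_gauss :: "('d::finite \<Rightarrow> real) measure" where
  "std_gauss = PiM UNIV (\<lambda>_. std_normal_distribution)"

text \<open>P(Z \<ge> z) for Z ~ N(0,V), realised as Z = A W with A A^T = V
  (the standard definition of a possibly degenerate multivariate normal law).\<close>
definition gauss_upper_prob :: "real^'d::finite^'d \<Rightarrow> real^'d \<Rightarrow> real" where
  "gauss_upper_prob V z =
     measure (std_gauss :: ('d \<Rightarrow> real) measure) {w \<in> space (std_gauss :: ('d \<Rightarrow> real) measure).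
        z \<le> (SOME A. A ** transpose A = V) *v (\<chi> i. w i)}"

end

theory Submission
  imports Defs
begin

text \<open>
  By a second-order Taylor expansion, \<open>g\<close> at the type differs from its linearisation by at most
  \<open>(\<kappa> + 1) / 2\<close> times the squared distance of the type to \<open>p\<close>. Writing \<open>exp (\<bar>u\<bar>\<^sup>2 / 2)\<close> as the Gaussian
  mean of \<open>exp (w \<bullet> u)\<close> and applying Hoeffding's lemma to the steps shows that this is at most \<open>b\<^sub>n\<close>
  outside an event of probability \<open>O(n\<^sup>-\<^sup>1\<^sup>/\<^sup>2)\<close>, so it remains to prove a Berry-Esseen bound on orthants
  for the linear part.

  Write the centred steps as \<open>A \<xi>\<close> with \<open>\<xi>\<close> isotropic, and exchange them for Gaussian ones one at a
  time (Lindeberg). When \<open>m\<close> steps are already Gaussian, adding one more step multiplies their density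
  by a likelihood ratio. Its mean depends on the law of that step only in the order \<open>m\<^sup>-\<^sup>3\<^sup>/\<^sup>2\<close>, as long
  as the law is isotropic, and no derivative of the indicator is needed. The exchange matters only
  if the walk of the remaining \<open>k\<close> steps is within \<open>O(\<surd>m)\<close> of one of the hyperplanes bounding the
  orthant, which by a one-dimensional Fourier estimate has probability \<open>O(\<surd>m / \<surd>k)\<close>. The sum of
  \<open>1 / (m \<surd>k)\<close> over \<open>m + k = n\<close> is \<open>O(log n / \<surd>n)\<close>.
\<close>

section \<open>Random walks with finitely supported steps\<close>

lemma expectation_bind_pmf_finite:
  fixes h :: "'b \<Rightarrow> 'c::{banach, second_countable_topology}"
  assumes "finite (set_pmf p)" "\<And>x. x \<in> set_pmf p \<Longrightarrow> finite (set_pmf (f x))"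
  shows "measure_pmf.expectation (bind_pmf p f) h =
    measure_pmf.expectation p (\<lambda>x. measure_pmf.expectation (f x) h)"
  using assms by (simp add: pmf_expectation_bind integral_measure_pmf[of "set_pmf p"])

lemma expectation_pmf_mono:
  fixes f g :: "'a \<Rightarrow> real"
  assumes "finite (set_pmf p)" "\<And>x. x \<in> set_pmf p \<Longrightarrow> f x \<le> g x"
  shows "measure_pmf.expectation p f \<le> measure_pmf.expectation p g"
  using assms
  by (intro integral_mono_AE) (auto simp: integrable_measure_pmf_finite AE_measure_pmf_iff)

definition walk_pmf :: "'v::comm_monoid_add pmf \<Rightarrow> nat \<Rightarrow> 'v pmf" where
  "walk_pmf P n = map_pmf sum_list (replicate_pmf n P)"

lemma walk_pmf_0 [simp]: "walk_pmf P 0 = return_pmf 0"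
  by (simp add: walk_pmf_def)

lemma walk_pmf_Suc: "walk_pmf P (Suc n) = bind_pmf (walk_pmf P n) (\<lambda>u. map_pmf ((+) u) P)"
proof -
  have "walk_pmf P (Suc n) =
      bind_pmf P (\<lambda>x. bind_pmf (replicate_pmf n P) (\<lambda>xs. return_pmf (sum_list xs + x)))"
    by (simp add: walk_pmf_def map_bind_pmf add.commute)
  also have "\<dots> = bind_pmf (walk_pmf P n) (\<lambda>u. map_pmf ((+) u) P)"
    by (subst bind_commute_pmf) (simp add: walk_pmf_def bind_map_pmf map_pmf_def[of "(+) _"])
  finally show ?thesis .
qed

lemma finite_set_pmf_walk: "finite (set_pmf P) \<Longrightarrow> finite (set_pmf (walk_pmf P n))"
  by (induction n) (simp_all add: walk_pmf_Suc)

lemma map_walk_pmf: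
  assumes "linear f"
  shows "map_pmf f (walk_pmf P n) = walk_pmf (map_pmf f P) n"
proof (induction n)
  case (Suc n)
  have "map_pmf f (walk_pmf P (Suc n)) =
      bind_pmf (map_pmf f (walk_pmf P n)) (\<lambda>u. map_pmf ((+) u) (map_pmf f P))"
    by (simp add: walk_pmf_Suc map_bind_pmf bind_map_pmf pmf.map_comp o_def linear_add[OF assms])
  thus ?case by (simp add: Suc.IH walk_pmf_Suc)
qed (simp add: linear_0[OF assms])

lemma expectation_walk_Suc:
  fixes h :: "'v::comm_monoid_add \<Rightarrow> 'c::{banach, second_countable_topology}"
  assumes "finite (set_pmf P)"
  shows "measure_pmf.expectation (walk_pmf P (Suc n)) h =
    measure_pmf.expectation (walk_pmf P n) (\<lambda>u. measure_pmf.expectation P (\<lambda>x. h (u + x)))"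
  using assms by (simp add: walk_pmf_Suc expectation_bind_pmf_finite finite_set_pmf_walk)

lemma expectation_walk_multiplicative:
  fixes f :: "'v::comm_monoid_add \<Rightarrow> 'c::{real_normed_field, banach, second_countable_topology}"
  assumes "finite (set_pmf P)" "f 0 = 1" "\<And>x y. f (x + y) = f x * f y"
  shows "measure_pmf.expectation (walk_pmf P n) f = measure_pmf.expectation P f ^ n"
  by (induction n) (use assms in \<open>simp_all add: expectation_walk_Suc\<close>)

section \<open>Anti-concentration of real random walks\<close>

lemma one_minus_cos_ge:
  fixes x :: real
  assumes "\<bar>x\<bar> \<le> 1"
  shows "x\<^sup>2 / 4 \<le> 1 - cos x"
proof -
  obtain t where "cos x =
      (\<Sum>m<4. cos_coeff m * x ^ m) + (cos (t + 1/2 * real 4 * pi) / fact 4) * x ^ 4"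
    using Maclaurin_cos_expansion[of x 4] by auto
  moreover have "(\<Sum>m<4. cos_coeff m * x ^ m) = 1 - x\<^sup>2 / 2"
    by (simp add: eval_nat_numeral) (simp add: cos_coeff_def)
  moreover have "(cos (t + 1/2 * real 4 * pi) / fact 4) * x ^ 4 \<le> (1 / 24) * x ^ 4"
    by (intro mult_right_mono) (simp_all add: fact_numeral)
  moreover have "x ^ 4 \<le> x\<^sup>2"
    using assms power_decreasing[of 2 4 "\<bar>x\<bar>"] by simp
  ultimately show ?thesis using zero_le_power2[of x] by linarith
qed

definition fejer :: "real \<Rightarrow> real" where
  "fejer x = (if x = 0 then 1 / 2 else (1 - cos x) / x\<^sup>2)"

lemma fejer_nonneg: "0 \<le> fejer x"
  by (simp add: fejer_def)

lemma fejer_ge: "\<bar>x\<bar> \<le> 1 \<Longrightarrow> 1 / 4 \<le> fejer x"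
  using one_minus_cos_ge[of x] by (simp add: fejer_def field_simps)

lemma fejer_has_integral: "((\<lambda>t. (1 - t) * cos (t * x)) has_integral fejer x) {0..1}"
proof (cases "x = 0")
  case True
  have "((\<lambda>t::real. 1 - t) has_integral (1 - 1\<^sup>2 / 2) - (0 - 0\<^sup>2 / 2)) {0..1}"
    by (intro fundamental_theorem_of_calculus)
       (auto intro!: derivative_eq_intros simp flip: has_real_derivative_iff_has_vector_derivative)
  thus ?thesis by (simp add: fejer_def True)
next
  case False
  have "((\<lambda>t. (1 - t) * cos (t * x)) has_integral
      ((1 - 1) * sin (1 * x) / x - cos (1 * x) / x\<^sup>2) -
      ((1 - 0) * sin (0 * x) / x - cos (0 * x) / x\<^sup>2)) {0..1}"
    using False
    by (intro fundamental_theorem_of_calculus)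
       (auto intro!: derivative_eq_intros simp: field_simps power2_eq_square
          simp flip: has_real_derivative_iff_has_vector_derivative)
  thus ?thesis using False by (simp add: fejer_def diff_divide_distrib)
qed

lemma norm_expectation_cis_le:
  fixes P :: "real pmf"
  assumes fin: "finite (set_pmf P)"
    and close: "\<And>x y. x \<in> set_pmf P \<Longrightarrow> y \<in> set_pmf P \<Longrightarrow> \<bar>t * (x - y)\<bar> \<le> 1"
  shows "cmod (measure_pmf.expectation P (\<lambda>x. cis (t * x))) \<le>
    exp (- t\<^sup>2 * measure_pmf.variance P (\<lambda>x. x) / 4)"
proof -
  note [simp] = integrable_measure_pmf_finite[OF fin]
  let ?E = "measure_pmf.expectation P"
  define \<mu> where "\<mu> = ?E (\<lambda>x. x)"
  define v where "v = ?E (\<lambda>x. (x - \<mu>)\<^sup>2)"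
  have inner_moment: "?E (\<lambda>y. (x - y)\<^sup>2) = (x - \<mu>)\<^sup>2 + v" for x
  proof -
    have "?E (\<lambda>y. (x - y)\<^sup>2) = ?E (\<lambda>y. (x - \<mu>)\<^sup>2 - 2 * (x - \<mu>) * (y - \<mu>) + (y - \<mu>)\<^sup>2)"
      by (intro Bochner_Integration.integral_cong refl) (simp add: power2_eq_square algebra_simps)
    also have "\<dots> = (x - \<mu>)\<^sup>2 - 2 * (x - \<mu>) * (?E (\<lambda>y. y) - \<mu>) + v"
      by (simp add: v_def)
    finally show ?thesis by (simp add: \<mu>_def)
  qed
  have "(cmod (?E (\<lambda>x. cis (t * x))))\<^sup>2 = (?E (\<lambda>x. cos (t * x)))\<^sup>2 + (?E (\<lambda>x. sin (t * x)))\<^sup>2"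
    by (simp add: cmod_power2 flip: integral_Re integral_Im)
  also have "\<dots> = ?E (\<lambda>x. ?E (\<lambda>y. cos (t * (x - y))))"
    by (simp add: right_diff_distrib cos_diff power2_eq_square)
  also have "\<dots> \<le> ?E (\<lambda>x. ?E (\<lambda>y. 1 - (t * (x - y))\<^sup>2 / 4))"
    using one_minus_cos_ge[OF close] by (intro expectation_pmf_mono fin) (simp add: algebra_simps)
  also have "\<dots> = 1 - t\<^sup>2 / 4 * ?E (\<lambda>x. ?E (\<lambda>y. (x - y)\<^sup>2))"
    by (simp add: power_mult_distrib)
  also have "\<dots> = 1 - t\<^sup>2 * v / 2"
    by (simp add: inner_moment) (simp add: v_def)
  also have "\<dots> \<le> exp (- t\<^sup>2 * v / 2)"
    using exp_ge_add_one_self[of "- t\<^sup>2 * v / 2"] by simp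
  also have "\<dots> = (exp (- t\<^sup>2 * v / 4))\<^sup>2"
    by (simp add: power2_eq_square flip: exp_add)
  finally show ?thesis unfolding v_def \<mu>_def by (rule power2_le_imp_le) simp
qed

lemma norm_expectation_cis_walk_le:
  fixes P :: "real pmf"
  assumes fin: "finite (set_pmf P)"
    and close: "\<And>x y. x \<in> set_pmf P \<Longrightarrow> y \<in> set_pmf P \<Longrightarrow> \<bar>t * (x - y)\<bar> \<le> 1"
  shows "cmod (measure_pmf.expectation (walk_pmf P n) (\<lambda>u. cis (t * u))) \<le>
    1 / (1 + real n * t\<^sup>2 * measure_pmf.variance P (\<lambda>x. x) / 4)"
proof -
  define s where "s = real n * t\<^sup>2 * measure_pmf.variance P (\<lambda>x. x) / 4"
  have "s \<ge> 0" by (simp add: s_def)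
  have "measure_pmf.expectation (walk_pmf P n) (\<lambda>u. cis (t * u)) =
      measure_pmf.expectation P (\<lambda>x. cis (t * x)) ^ n"
    by (rule expectation_walk_multiplicative[OF fin]) (simp_all add: cis_mult distrib_left)
  hence "cmod (measure_pmf.expectation (walk_pmf P n) (\<lambda>u. cis (t * u))) \<le>
      exp (- t\<^sup>2 * measure_pmf.variance P (\<lambda>x. x) / 4) ^ n"
    using norm_expectation_cis_le[OF fin close] by (simp add: norm_power power_mono)
  also have "\<dots> = exp (- s)"
    by (simp add: s_def mult_ac flip: exp_of_nat_mult)
  also have "\<dots> \<le> 1 / (1 + s)"
    using exp_ge_add_one_self[of s] \<open>s \<ge> 0\<close> by (simp add: exp_minus field_simps)
  finally show ?thesis by (simp add: s_def)
qed

lemma integral_inverse_quadratic_le: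
  fixes c :: real
  assumes "c > 0"
  shows "(\<lambda>t. 1 / (1 + (c * t)\<^sup>2)) integrable_on {0..1}"
    and "integral {0..1} (\<lambda>t. 1 / (1 + (c * t)\<^sup>2)) \<le> 2 / c"
proof -
  have "((\<lambda>t. 1 / (1 + (c * t)\<^sup>2)) has_integral (arctan (c * 1) / c - arctan (c * 0) / c)) {0..1}"
    using assms
    by (intro fundamental_theorem_of_calculus)
       (auto intro!: derivative_eq_intros simp: inverse_eq_divide
          simp flip: has_real_derivative_iff_has_vector_derivative)
  moreover have "arctan c \<le> 2"
    using arctan_ubound[of c] pi_less_4 by linarith
  ultimately show "(\<lambda>t. 1 / (1 + (c * t)\<^sup>2)) integrable_on {0..1}"
    "integral {0..1} (\<lambda>t. 1 / (1 + (c * t)\<^sup>2)) \<le> 2 / c"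
    using assms by (auto simp: has_integral_integrable_integral divide_right_mono)
qed

lemma expectation_fejer_has_integral:
  assumes "finite (set_pmf P)"
  shows "((\<lambda>t. (1 - t) * Re (cis (- t * z) * measure_pmf.expectation P (\<lambda>x. cis (t * x))))
    has_integral measure_pmf.expectation P (\<lambda>x. fejer (x - z))) {0..1}"
proof -
  note [simp] = integrable_measure_pmf_finite[OF assms]
  have "Re (cis (- t * z) * measure_pmf.expectation P (\<lambda>x. cis (t * x))) =
      measure_pmf.expectation P (\<lambda>x. cos (t * (x - z)))" for t
  proof -
    have "Re (cis (- t * z) * measure_pmf.expectation P (\<lambda>x. cis (t * x))) =
        Re (measure_pmf.expectation P (\<lambda>x. cis (t * (x - z))))"
      by (simp add: cis_mult right_diff_distrib flip: integral_mult_right_zero)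
    thus ?thesis by (simp flip: integral_Re)
  qed
  moreover have "((\<lambda>t. \<Sum>x\<in>set_pmf P. pmf P x * ((1 - t) * cos (t * (x - z)))) has_integral
      (\<Sum>x\<in>set_pmf P. pmf P x * fejer (x - z))) {0..1}"
    by (intro has_integral_sum assms has_integral_mult_right fejer_has_integral)
  ultimately show ?thesis
    by (simp add: integral_measure_pmf[OF assms] sum_distrib_left mult_ac)
qed

lemma prob_walk_interval_le:
  fixes P :: "real pmf"
  assumes fin: "finite (set_pmf P)"
    and var: "measure_pmf.variance P (\<lambda>x. x) > 0"
    and L: "L > 0" "\<And>x y. x \<in> set_pmf P \<Longrightarrow> y \<in> set_pmf P \<Longrightarrow> \<bar>x - y\<bar> \<le> L"
    and n: "n > 0"
  shows "measure_pmf.prob (walk_pmf P n) {u. \<bar>u - z\<bar> \<le> L} \<le>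
    16 * L / (sqrt (measure_pmf.variance P (\<lambda>x. x)) * sqrt n)"
proof -
  define v where "v = measure_pmf.variance P (\<lambda>x. x)"
  define c where "c = sqrt v * sqrt n / (2 * L)"
  define W where "W = map_pmf (\<lambda>u. u / L) (walk_pmf P n)"
  have c: "c > 0" using var L n by (simp add: c_def v_def)
  have fin_W: "finite (set_pmf W)" by (simp add: W_def finite_set_pmf_walk fin)
  have char_W: "cmod (measure_pmf.expectation W (\<lambda>x. cis (t * x))) \<le> 1 / (1 + (c * t)\<^sup>2)"
    if t: "t \<in> {0..1}" for t
  proof -
    have "\<bar>t / L * (x - y)\<bar> \<le> 1" if "x \<in> set_pmf P" "y \<in> set_pmf P" for x y
      using mult_mono[of "\<bar>t\<bar>" 1 "\<bar>x - y\<bar>" L] L that t by (simp add: abs_mult)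
    from norm_expectation_cis_walk_le[OF fin this] show ?thesis
      using var by (simp add: W_def c_def v_def power_mult_distrib power_divide mult_ac)
  qed
  have "measure_pmf.prob (walk_pmf P n) {u. \<bar>u - z\<bar> \<le> L} =
      measure_pmf.expectation W (indicator {x. \<bar>x - z / L\<bar> \<le> 1})"
    using L
    by (auto simp: W_def vimage_def field_simps abs_le_iff
        intro!: arg_cong[where f = "measure_pmf.prob _"])
  also have "\<dots> \<le> measure_pmf.expectation W (\<lambda>x. 4 * fejer (x - z / L))"
    by (intro expectation_pmf_mono fin_W) (auto simp: indicator_def fejer_nonneg dest!: fejer_ge)
  also have "\<dots> = 4 * measure_pmf.expectation W (\<lambda>x. fejer (x - z / L))"
    by simp
  also have "measure_pmf.expectation W (\<lambda>x. fejer (x - z / L)) \<le>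
      integral {0..1} (\<lambda>t. 1 / (1 + (c * t)\<^sup>2))"
  proof (rule has_integral_le[OF expectation_fejer_has_integral[OF fin_W]])
    show "((\<lambda>t. 1 / (1 + (c * t)\<^sup>2)) has_integral integral {0..1} (\<lambda>t. 1 / (1 + (c * t)\<^sup>2))) {0..1}"
      using integral_inverse_quadratic_le(1)[OF c] by (rule integrable_integral)
    fix t :: real assume t: "t \<in> {0..1}"
    have "Re (cis (- t * (z / L)) * measure_pmf.expectation W (\<lambda>x. cis (t * x))) \<le>
        1 / (1 + (c * t)\<^sup>2)"
      using char_W[OF t] by (intro order_trans[OF complex_Re_le_cmod]) (simp add: norm_mult)
    hence "(1 - t) * Re (cis (- t * (z / L)) * measure_pmf.expectation W (\<lambda>x. cis (t * x))) \<le>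
        (1 - t) * (1 / (1 + (c * t)\<^sup>2))"
      using t by (intro mult_left_mono) auto
    also have "\<dots> \<le> 1 * (1 / (1 + (c * t)\<^sup>2))"
      using t by (intro mult_right_mono) auto
    finally show "(1 - t) * Re (cis (- t * (z / L)) * measure_pmf.expectation W (\<lambda>x. cis (t * x))) \<le>
        1 / (1 + (c * t)\<^sup>2)" by simp
  qed
  also have "\<dots> \<le> 2 / c"
    by (rule integral_inverse_quadratic_le(2)[OF c])
  finally show ?thesis by (simp add: c_def v_def)
qed

lemma inverse_sqrt_le_two_inverse_sqrt_Suc:
  assumes "n > 0"
  shows "1 / sqrt (real n) \<le> 2 / sqrt (real n + 1)"
proof -
  have "sqrt (real n + 1) \<le> sqrt (4 * real n)"
    using assms by (intro real_sqrt_le_mono) linarith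
  thus ?thesis
    using assms by (simp add: real_sqrt_mult field_simps)
qed

lemma prob_walk_interval_le_uniform:
  fixes P :: "real pmf"
  assumes fin: "finite (set_pmf P)" and var: "measure_pmf.variance P (\<lambda>x. x) > 0"
  shows "\<exists>C\<ge>0. \<forall>n z L. L \<ge> 0 \<longrightarrow>
    measure_pmf.prob (walk_pmf P n) {u. \<bar>u - z\<bar> \<le> L} \<le> C * (L + 1) / sqrt (real n + 1)"
proof -
  define \<sigma> where "\<sigma> = sqrt (measure_pmf.variance P (\<lambda>x. x))"
  define D where "D = 1 + diameter (set_pmf P)"
  define C where "C = 1 + 32 * D / \<sigma>"
  have "bounded (set_pmf P)" by (rule finite_imp_bounded[OF fin])
  hence D: "\<bar>x - y\<bar> \<le> D" if "x \<in> set_pmf P" "y \<in> set_pmf P" for x y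
    using diameter_bounded_bound[of "set_pmf P" x y] that by (simp add: D_def dist_real_def)
  have D1: "D \<ge> 1" using diameter_ge_0[OF \<open>bounded (set_pmf P)\<close>] by (simp add: D_def)
  have \<sigma>: "\<sigma> > 0" using var by (simp add: \<sigma>_def)
  have C: "C \<ge> 1" using D1 \<sigma> by (simp add: C_def)
  have "measure_pmf.prob (walk_pmf P n) {u. \<bar>u - z\<bar> \<le> L} \<le> C * (L + 1) / sqrt (real n + 1)"
    if L: "L \<ge> 0" for n z L
  proof (cases "n = 0")
    case True
    have "1 \<le> C * (L + 1)" using C L by (intro mult_ge1_I) auto
    thus ?thesis using True by (auto simp: indicator_def)
  next
    case False
    define L' where "L' = D * (L + 1)"
    have L': "L \<le> L'" "D \<le> L'"
      using D1 L mult_right_mono[of 1 D L] by (auto simp: L'_def distrib_left)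
    have "measure_pmf.prob (walk_pmf P n) {u. \<bar>u - z\<bar> \<le> L} \<le>
        measure_pmf.prob (walk_pmf P n) {u. \<bar>u - z\<bar> \<le> L'}"
      using L' by (intro measure_pmf.finite_measure_mono) auto
    also have "\<dots> \<le> 16 * L' / (\<sigma> * sqrt n)"
      unfolding \<sigma>_def using False D1 D L' by (intro prob_walk_interval_le fin var) fastforce+
    also have "\<dots> = 16 * D * (L + 1) / \<sigma> * (1 / sqrt (real n))"
      by (simp add: L'_def)
    also have "\<dots> \<le> 16 * D * (L + 1) / \<sigma> * (2 / sqrt (real n + 1))"
      using False D1 L \<sigma> by (intro mult_left_mono inverse_sqrt_le_two_inverse_sqrt_Suc) auto
    also have "\<dots> = 32 * D / \<sigma> * (L + 1) / sqrt (real n + 1)"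
      by simp
    also have "\<dots> \<le> C * (L + 1) / sqrt (real n + 1)"
      using L by (intro divide_right_mono mult_right_mono) (simp_all add: C_def)
    finally show ?thesis .
  qed
  thus ?thesis using C by (intro exI[of _ C]) auto
qed

section \<open>The standard Gaussian measure\<close>

definition gauss_density :: "real^'d::finite \<Rightarrow> real" where
  "gauss_density w = (\<Prod>i\<in>UNIV. std_normal_density (w $ i))"

definition gauss_measure :: "(real^'d::finite) measure" where
  "gauss_measure = density lborel (\<lambda>w. ennreal (gauss_density w))"

lemma power2_norm_vec: "(norm (w :: real^'d::finite))\<^sup>2 = (\<Sum>i\<in>UNIV. (w $ i)\<^sup>2)"
  unfolding power2_norm_eq_inner inner_vec_def by (simp add: power2_eq_square)

lemma gauss_density_eq:
  "gauss_density (w :: real^'d::finite) = (1 / sqrt (2 * pi)) ^ CARD('d) * exp (- (norm w)\<^sup>2 / 2)"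
  by (simp add: gauss_density_def std_normal_density_def prod.distrib power2_norm_vec
      sum_divide_distrib power_one_over prod_dividef flip: exp_sum sum_negf)

lemma gauss_density_nonneg [simp]: "0 \<le> gauss_density w"
  by (simp add: gauss_density_def prod_nonneg)

lemma borel_measurable_gauss_density [measurable]: "gauss_density \<in> borel_measurable borel"
proof -
  have "continuous_on UNIV (gauss_density :: real^'d \<Rightarrow> real)"
    unfolding gauss_density_eq[abs_def] by (intro continuous_intros) auto
  thus ?thesis by (rule borel_measurable_continuous_onI)
qed

lemma sets_gauss_measure [measurable_cong, simp]: "sets gauss_measure = sets borel"
  and space_gauss_measure [simp]: "space gauss_measure = UNIV"
  by (simp_all add: gauss_measure_def)

lemma nn_integral_lborel_vec_prod:
  fixes f :: "'d::finite \<Rightarrow> real \<Rightarrow> ennreal"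
  assumes "\<And>i. f i \<in> borel_measurable borel"
  shows "(\<integral>\<^sup>+w. (\<Prod>i\<in>UNIV. f i ((w :: real^'d) $ i)) \<partial>lborel) = (\<Prod>i\<in>UNIV. \<integral>\<^sup>+x. f i x \<partial>lborel)"
proof -
  define index where "index b = (THE i. b = axis i (1::real))" for b :: "real^'d"
  have index: "index (axis i 1) = i" for i
    unfolding index_def by (rule the_equality) (auto simp: axis_eq_axis)
  have Basis: "(Basis :: (real^'d) set) = (\<lambda>i. axis i 1) ` UNIV"
    by (auto simp: Basis_vec_def)
  have inj: "inj (\<lambda>i. axis i (1::real) :: real^'d)"
    by (auto simp: inj_def axis_eq_axis)
  show ?thesis
    using nn_integral_lborel_prod[of "\<lambda>b. f (index b)"] assms
    by (simp add: Basis prod.reindex[OF inj] index inner_axis o_def)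
qed

lemma measurable_vec_to_PiM:
  "(\<lambda>v. \<lambda>i. v $ i) \<in> gauss_measure \<rightarrow>\<^sub>M PiM UNIV (\<lambda>_::'d::finite. std_normal_distribution)"
proof (rule measurable_PiM_single')
  fix i :: 'd
  have "(\<lambda>v::real^'d. v $ i) \<in> borel_measurable borel"
    by (intro borel_measurable_continuous_onI continuous_intros)
  thus "(\<lambda>v. v $ i) \<in> gauss_measure \<rightarrow>\<^sub>M std_normal_distribution"
    by (simp add: measurable_cong_sets[OF sets_gauss_measure sets_density])
qed (auto simp: space_PiM)

lemma std_gauss_eq_distr:
  "(std_gauss :: ('d::finite \<Rightarrow> real) measure) =
     distr gauss_measure (PiM UNIV (\<lambda>_. std_normal_distribution)) (\<lambda>v. \<lambda>i. v $ i)"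
  unfolding std_gauss_def
proof (rule sym, rule product_sigma_finite.PiM_eqI)
  let ?P = "PiM UNIV (\<lambda>_::'d. std_normal_distribution)"
  show "product_sigma_finite (\<lambda>_::'d. std_normal_distribution)"
    by (intro product_sigma_finite.intro prob_space_imp_sigma_finite prob_space_normal_density) simp
  have [measurable]: "(\<lambda>v. \<lambda>i. v $ i) \<in> gauss_measure \<rightarrow>\<^sub>M ?P"
    by (rule measurable_vec_to_PiM)
  fix A :: "'d \<Rightarrow> real set" assume A: "\<And>i. i \<in> UNIV \<Longrightarrow> A i \<in> sets std_normal_distribution"
  have [measurable]: "A i \<in> sets borel" for i using A by simp
  have "Pi\<^sub>E UNIV A \<in> sets ?P"
    using A by (intro sets_PiM_I_finite) auto
  hence "emeasure (distr gauss_measure ?P (\<lambda>v. \<lambda>i. v $ i)) (Pi\<^sub>E UNIV A) =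
     emeasure gauss_measure {v. \<forall>i. v $ i \<in> A i}"
    by (subst emeasure_distr) (auto intro!: arg_cong2[where f = emeasure])
  also have "\<dots> = (\<integral>\<^sup>+v. ennreal (gauss_density v) * indicator {v. \<forall>i. v $ i \<in> A i} v \<partial>lborel)"
    unfolding gauss_measure_def by (subst emeasure_density) auto
  also have "\<dots> =
      (\<integral>\<^sup>+v. (\<Prod>i\<in>UNIV. ennreal (std_normal_density (v $ i)) * indicator (A i) (v $ i)) \<partial>lborel)"
    by (intro nn_integral_cong)
       (auto simp: gauss_density_def prod_ennreal prod.distrib indicator_def prod_zero_iff
          split: if_splits)
  also have "\<dots> = (\<Prod>i\<in>UNIV. \<integral>\<^sup>+x. ennreal (std_normal_density x) * indicator (A i) x \<partial>lborel)"
    by (rule nn_integral_lborel_vec_prod) measurable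
  also have "\<dots> = (\<Prod>i\<in>UNIV. emeasure std_normal_distribution (A i))"
    by (intro prod.cong refl) (simp add: emeasure_density)
  finally show "emeasure (distr gauss_measure ?P (\<lambda>v. \<lambda>i. v $ i)) (Pi\<^sub>E UNIV A) =
     (\<Prod>i\<in>UNIV. emeasure std_normal_distribution (A i))" .
qed auto

lemma prob_space_gauss_measure: "prob_space (gauss_measure :: (real^'d::finite) measure)"
proof (rule prob_space_distrD[OF measurable_vec_to_PiM])
  have "prob_space (std_gauss :: ('d \<Rightarrow> real) measure)"
    unfolding std_gauss_def by (intro prob_space_PiM prob_space_normal_density) simp
  thus "prob_space
      (distr gauss_measure (PiM UNIV (\<lambda>_. std_normal_distribution)) (\<lambda>v (i :: 'd). v $ i))"
    by (simp only: std_gauss_eq_distr)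
qed

interpretation gauss: prob_space "gauss_measure :: (real^'d::finite) measure"
  by (rule prob_space_gauss_measure)

lemma measure_gauss_measure_UNIV [simp]:
  "measure (gauss_measure :: (real^'d::finite) measure) UNIV = 1"
  using gauss.prob_space by simp

lemma closed_upper_orthant_preimage: "closed {w. c \<le> (A :: real^'d::finite^'e::finite) *v w}"
proof -
  have "{w. c \<le> A *v w} = (\<Inter>i. {w. c $ i \<le> (A *v w) $ i})"
    by (auto simp: less_eq_vec_def)
  also have "closed \<dots>"
    by (intro closed_INT ballI closed_Collect_le continuous_intros)
  finally show ?thesis .
qed

lemma measure_std_gauss_eq_gauss_measure:
  fixes B :: "(real^'d::finite) set"
  assumes "B \<in> sets borel"
  shows "measure (std_gauss :: ('d \<Rightarrow> real) measure) {w \<in> space std_gauss. (\<chi> i. w i) \<in> B} =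
    measure gauss_measure B"
proof -
  let ?P = "PiM UNIV (\<lambda>_::'d. std_normal_distribution)"
  have "(\<lambda>w. w i) \<in> borel_measurable ?P" for i
    using measurable_component_singleton[of i UNIV "\<lambda>_. std_normal_distribution"]
    by (simp add: measurable_cong_sets[OF refl sets_density])
  hence "(\<lambda>w. \<chi> i. w i) \<in> borel_measurable ?P"
    by (subst borel_measurable_euclidean_space) (auto simp: Basis_vec_def inner_axis)
  hence "{w \<in> space ?P. (\<chi> i. w i) \<in> B} \<in> sets ?P"
    using assms by measurable
  thus ?thesis
    unfolding std_gauss_eq_distr
    by (subst measure_distr[OF measurable_vec_to_PiM])
       (auto intro!: arg_cong2[where f = measure] simp: space_PiM)
qed

lemma gauss_integral_prod:
  fixes f :: "'d::finite \<Rightarrow> real \<Rightarrow> real"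
  assumes "\<And>i. integrable std_normal_distribution (f i)"
  shows "integrable gauss_measure (\<lambda>w. \<Prod>i\<in>UNIV. f i (w $ i))"
    and "(\<integral>w. (\<Prod>i\<in>UNIV. f i (w $ i)) \<partial>gauss_measure) =
      (\<Prod>i\<in>UNIV. \<integral>x. f i x \<partial>std_normal_distribution)"
proof -
  let ?P = "PiM UNIV (\<lambda>_::'d. std_normal_distribution)"
  interpret product_sigma_finite "\<lambda>_::'d. std_normal_distribution"
    by (intro product_sigma_finite.intro prob_space_imp_sigma_finite prob_space_normal_density) simp
  have distr: "?P = distr gauss_measure ?P (\<lambda>v. \<lambda>i. v $ i)"
    using std_gauss_eq_distr by (simp add: std_gauss_def)
  have int: "integrable ?P (\<lambda>x. \<Prod>i\<in>UNIV. f i (x i))"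
    using assms by (intro product_integrable_prod) auto
  thus "integrable gauss_measure (\<lambda>w. \<Prod>i\<in>UNIV. f i (w $ i))"
    by (subst (asm) distr, subst (asm) integrable_distr_eq[OF measurable_vec_to_PiM])
       (use int in \<open>auto dest: borel_measurable_integrable\<close>)
  have "(\<integral>w. (\<Prod>i\<in>UNIV. f i (w $ i)) \<partial>gauss_measure) = (\<integral>x. (\<Prod>i\<in>UNIV. f i (x i)) \<partial>?P)"
    by (subst distr, subst integral_distr[OF measurable_vec_to_PiM])
       (use int in \<open>auto dest: borel_measurable_integrable\<close>)
  also have "\<dots> = (\<Prod>i\<in>UNIV. \<integral>x. f i x \<partial>std_normal_distribution)"
    using assms by (intro product_integral_prod) auto
  finally show "(\<integral>w. (\<Prod>i\<in>UNIV. f i (w $ i)) \<partial>gauss_measure) =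
      (\<Prod>i\<in>UNIV. \<integral>x. f i x \<partial>std_normal_distribution)" .
qed

lemma std_normal_distribution_moments:
  "integrable std_normal_distribution (\<lambda>x. x ^ k)"
  "(\<integral>x. x \<partial>std_normal_distribution) = 0" "(\<integral>x. x\<^sup>2 \<partial>std_normal_distribution) = 1"
proof -
  have "integrable lborel (\<lambda>x. std_normal_density x * x ^ k)"
    by (rule integrable_std_normal_moment)
  thus "integrable std_normal_distribution (\<lambda>x. x ^ k)"
    by (subst integrable_density) auto
  show "(\<integral>x. x \<partial>std_normal_distribution) = 0"
    using integral_std_normal_moment_odd[of 0] by (subst integral_density) auto
  show "(\<integral>x. x\<^sup>2 \<partial>std_normal_distribution) = 1"
    using integral_std_normal_moment_even[of 1] by (subst integral_density) auto
qed

lemma gauss_component_moments: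
  fixes i j :: "'d::finite"
  shows "integrable gauss_measure (\<lambda>w. w $ i)" "(\<integral>w. w $ i \<partial>gauss_measure) = 0"
    and "integrable gauss_measure (\<lambda>w. w $ i * w $ j)"
      "(\<integral>w. w $ i * w $ j \<partial>gauss_measure) = of_bool (i = j)"
proof -
  interpret N: prob_space std_normal_distribution
    by (rule prob_space_normal_density) simp
  have [simp]: "N.prob UNIV = 1" using N.prob_space by simp
  define f where "f k x = (if k = i then x else 1)" for k and x :: real
  define g where "g k x = (if k = i then x else 1) * (if k = j then x else 1)" for k and x :: real
  have int_f: "integrable std_normal_distribution (f k)" for k
    using std_normal_distribution_moments(1)[of 1] by (cases "k = i") (auto simp: f_def[abs_def])
  have int_g: "integrable std_normal_distribution (g k)" for k
    using std_normal_distribution_moments(1)[of 1] std_normal_distribution_moments(1)[of 2]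
    by (cases "k = i"; cases "k = j") (simp_all add: g_def[abs_def] power2_eq_square)
  have f: "(\<Prod>k\<in>UNIV. f k (w $ k)) = w $ i" for w
    by (simp add: f_def prod.delta)
  have g: "(\<Prod>k\<in>UNIV. g k (w $ k)) = w $ i * w $ j" for w
    by (simp add: g_def prod.distrib prod.delta)
  have integral_f: "(\<integral>x. f k x \<partial>std_normal_distribution) = of_bool (k \<noteq> i)" for k
    by (simp add: f_def std_normal_distribution_moments)
  have integral_g: "(\<integral>x. g k x \<partial>std_normal_distribution) = of_bool (k = i \<longleftrightarrow> k = j)" for k
    using std_normal_distribution_moments(2,3)
    by (auto simp: g_def power2_eq_square)
  show "integrable gauss_measure (\<lambda>w. w $ i)" "(\<integral>w. w $ i \<partial>gauss_measure) = 0"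
    using gauss_integral_prod[of f, OF int_f] by (auto simp: f integral_f)
  show "integrable gauss_measure (\<lambda>w. w $ i * w $ j)"
      "(\<integral>w. w $ i * w $ j \<partial>gauss_measure) = of_bool (i = j)"
    using gauss_integral_prod[of g, OF int_g] by (cases "i = j"; force simp: g integral_g)+
qed

lemma lborel_integral_affine:
  fixes f :: "'a::euclidean_space \<Rightarrow> real"
  assumes c: "c > 0" and [measurable]: "f \<in> borel_measurable borel"
  shows "(\<integral>x. f x \<partial>lborel) = c ^ DIM('a) * (\<integral>x. f (t + c *\<^sub>R x) \<partial>lborel)"
    and "integrable lborel f \<longleftrightarrow> integrable lborel (\<lambda>x. f (t + c *\<^sub>R x))"
proof -
  have lborel_eq: "(lborel :: 'a measure) =
      density (distr lborel borel (\<lambda>x. t + c *\<^sub>R x)) (\<lambda>_. ennreal (c ^ DIM('a)))"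
    using lborel_affine[of c t] c by simp
  have [measurable]: "(\<lambda>x. t + c *\<^sub>R x) \<in> borel \<rightarrow>\<^sub>M borel" by simp
  show "(\<integral>x. f x \<partial>lborel) = c ^ DIM('a) * (\<integral>x. f (t + c *\<^sub>R x) \<partial>lborel)"
    using c by (subst lborel_eq) (simp add: integral_density integral_distr)
  show "integrable lborel f \<longleftrightarrow> integrable lborel (\<lambda>x. f (t + c *\<^sub>R x))"
    using c by (subst lborel_eq) (simp add: integrable_density integrable_distr_eq)
qed

lemma gauss_integral_eq:
  fixes F :: "real^'d::finite \<Rightarrow> real"
  assumes [measurable]: "F \<in> borel_measurable borel"
  shows "(\<integral>w. F w \<partial>gauss_measure) = (\<integral>w. gauss_density w * F w \<partial>lborel)"
  unfolding gauss_measure_def by (subst integral_density) auto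

lemma gauss_integrable_iff:
  fixes F :: "real^'d::finite \<Rightarrow> real"
  assumes [measurable]: "F \<in> borel_measurable borel"
  shows "integrable gauss_measure F \<longleftrightarrow> integrable lborel (\<lambda>w. gauss_density w * F w)"
  unfolding gauss_measure_def by (subst integrable_density) auto

definition shift_density :: "'v::real_inner \<Rightarrow> 'v \<Rightarrow> real" where
  "shift_density y w = exp (w \<bullet> y - (norm y)\<^sup>2 / 2)"

lemma borel_measurable_shift_density [measurable]:
  assumes [measurable]: "f \<in> borel_measurable M" "g \<in> borel_measurable M"
  shows "(\<lambda>x. shift_density (f x) (g x :: 'v::euclidean_space)) \<in> borel_measurable M"
  unfolding shift_density_def by measurable

lemma gauss_integral_shift:
  fixes F :: "real^'d::finite \<Rightarrow> real"
  assumes [measurable]: "F \<in> borel_measurable borel"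
  shows "(\<integral>w. F (w + y) \<partial>gauss_measure) = (\<integral>w. shift_density y w * F w \<partial>gauss_measure)"
proof -
  have "(\<integral>w. F (w + y) \<partial>gauss_measure) = (\<integral>w. gauss_density w * F (w + y) \<partial>lborel)"
    by (rule gauss_integral_eq) measurable
  also have "\<dots> = (\<integral>w. gauss_density (w - y) * F w \<partial>lborel)"
    by (subst (2) lborel_integral_affine[of 1 _ y]) (simp_all add: add.commute)
  also have "\<dots> = (\<integral>w. gauss_density w * (shift_density y w * F w) \<partial>lborel)"
    by (intro Bochner_Integration.integral_cong refl)
       (simp add: gauss_density_eq shift_density_def power2_norm_eq_inner inner_diff field_simps
          inner_commute flip: exp_add)
  also have "\<dots> = (\<integral>w. shift_density y w * F w \<partial>gauss_measure)"
    by (rule gauss_integral_eq[symmetric]) measurable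
  finally show ?thesis .
qed

lemma gauss_integral_exp_inner:
  "(\<integral>w. exp (w \<bullet> y) \<partial>gauss_measure) = exp ((norm (y :: real^'d::finite))\<^sup>2 / 2)"
proof -
  have "(\<integral>w. shift_density y w \<partial>gauss_measure) = 1"
    using gauss_integral_shift[of "\<lambda>_. 1" y] by simp
  thus ?thesis
    by (simp add: shift_density_def exp_diff)
qed

lemma gauss_integral_scale:
  fixes F :: "real^'d::finite \<Rightarrow> real"
  assumes [measurable]: "F \<in> borel_measurable borel" and s: "s > 0"
  shows "(\<integral>w. F (s *\<^sub>R w) \<partial>gauss_measure) =
    (\<integral>w. (exp ((norm w)\<^sup>2 * (1 - 1 / s\<^sup>2) / 2) / s ^ CARD('d)) * F w \<partial>gauss_measure)"
proof -
  have "(\<integral>w. F (s *\<^sub>R w) \<partial>gauss_measure) = (\<integral>w. gauss_density w * F (s *\<^sub>R w) \<partial>lborel)"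
    by (rule gauss_integral_eq) measurable
  also have "\<dots> = (\<integral>w. gauss_density ((1 / s) *\<^sub>R w) * F w \<partial>lborel) / s ^ CARD('d)"
    using s by (subst (2) lborel_integral_affine[of s _ 0]) simp_all
  also have "\<dots> = (\<integral>w. gauss_density ((1 / s) *\<^sub>R w) * F w / s ^ CARD('d) \<partial>lborel)"
    by simp
  also have "\<dots> =
      (\<integral>w. gauss_density w * ((exp ((norm w)\<^sup>2 * (1 - 1 / s\<^sup>2) / 2) / s ^ CARD('d)) * F w) \<partial>lborel)"
    by (intro Bochner_Integration.integral_cong refl)
       (simp add: gauss_density_eq field_simps power_mult_distrib flip: exp_add)
  also have "\<dots> = (\<integral>w. (exp ((norm w)\<^sup>2 * (1 - 1 / s\<^sup>2) / 2) / s ^ CARD('d)) * F w \<partial>gauss_measure)"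
    by (rule gauss_integral_eq[symmetric]) measurable
  finally show ?thesis .
qed

lemma gauss_integral_shift_density:
  fixes w :: "real^'d::finite"
  shows "(\<integral>x. shift_density (\<epsilon> *\<^sub>R x) w \<partial>gauss_measure) =
    exp ((norm w)\<^sup>2 * (1 - 1 / (1 + \<epsilon>\<^sup>2)) / 2) / sqrt (1 + \<epsilon>\<^sup>2) ^ CARD('d)"
proof -
  define s where "s = 1 / sqrt (1 + \<epsilon>\<^sup>2)"
  have pos: "1 + \<epsilon>\<^sup>2 > 0" by (simp add: add_pos_nonneg)
  have s: "s > 0" "s\<^sup>2 = 1 / (1 + \<epsilon>\<^sup>2)" using pos by (simp_all add: s_def power_divide)
  have "(\<integral>x. exp (s *\<^sub>R x \<bullet> \<epsilon> *\<^sub>R w) \<partial>gauss_measure) =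
      (\<integral>x. exp ((norm x)\<^sup>2 * (1 - 1 / s\<^sup>2) / 2) / s ^ CARD('d) * exp (x \<bullet> \<epsilon> *\<^sub>R w) \<partial>gauss_measure)"
    by (rule gauss_integral_scale[OF _ s(1)]) measurable
  also have "\<dots> = (\<integral>x. shift_density (\<epsilon> *\<^sub>R x) w / s ^ CARD('d) \<partial>gauss_measure)"
    using pos by (intro Bochner_Integration.integral_cong refl)
       (simp add: s(2) shift_density_def inner_commute power_mult_distrib field_simps flip: exp_add)
  finally have "(\<integral>x. shift_density (\<epsilon> *\<^sub>R x) w \<partial>gauss_measure) =
      s ^ CARD('d) * (\<integral>x. exp (x \<bullet> (s * \<epsilon>) *\<^sub>R w) \<partial>gauss_measure)"
    using s(1) by (simp add: field_simps)
  also have "\<dots> = s ^ CARD('d) * exp (s\<^sup>2 * (\<epsilon>\<^sup>2 * (norm w)\<^sup>2) / 2)"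
    by (simp only: gauss_integral_exp_inner) (simp add: power_mult_distrib mult_ac)
  also have "s\<^sup>2 * (\<epsilon>\<^sup>2 * (norm w)\<^sup>2) = (norm w)\<^sup>2 * (1 - 1 / (1 + \<epsilon>\<^sup>2))"
    using pos by (simp add: s(2) field_simps)
  finally show ?thesis by (simp add: s_def power_one_over)
qed

text \<open>Both sides are the mean of \<open>F (w + \<epsilon> x)\<close> over independent Gaussian \<open>w\<close> and \<open>x\<close>.\<close>

lemma gauss_integral_convolution:
  fixes F :: "real^'d::finite \<Rightarrow> real"
  assumes [measurable]: "F \<in> borel_measurable borel"
  shows "(\<integral>w. F (sqrt (1 + \<epsilon>\<^sup>2) *\<^sub>R w) \<partial>gauss_measure) =
    (\<integral>w. (\<integral>x. shift_density (\<epsilon> *\<^sub>R x) w \<partial>gauss_measure) * F w \<partial>gauss_measure)"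
  using gauss_integral_scale[OF assms, of "sqrt (1 + \<epsilon>\<^sup>2)"]
  by (simp add: gauss_integral_shift_density add_pos_nonneg)

lemma gauss_integrable_exp_norm:
  assumes "c < 1 / 2"
  shows "integrable gauss_measure (\<lambda>w::real^'d::finite. exp (c * (norm w)\<^sup>2))"
proof -
  have "integrable gauss_measure (\<lambda>w::real^'d. 1 :: real)" by simp
  hence "integrable lborel (gauss_density :: real^'d \<Rightarrow> real)"
    by (subst (asm) gauss_integrable_iff) auto
  hence "integrable lborel (\<lambda>w::real^'d. gauss_density (0 + sqrt (1 - 2 * c) *\<^sub>R w))"
    using assms by (subst (asm) lborel_integral_affine(2)[of "sqrt (1 - 2 * c)" _ 0]) auto
  also have "(\<lambda>w::real^'d. gauss_density (0 + sqrt (1 - 2 * c) *\<^sub>R w)) =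
      (\<lambda>w. gauss_density w * exp (c * (norm w)\<^sup>2))"
    using assms
    by (auto simp: gauss_density_eq fun_eq_iff power_mult_distrib field_simps simp flip: exp_add)
  finally show ?thesis by (subst gauss_integrable_iff) auto
qed

lemma gauss_integrable_exp_inner:
  "integrable gauss_measure (\<lambda>w::real^'d::finite. exp (w \<bullet> y))"
proof (rule Bochner_Integration.integrable_bound)
  show "integrable gauss_measure (\<lambda>w::real^'d. exp ((norm y)\<^sup>2) * exp (1 / 4 * (norm w)\<^sup>2))"
    by (intro integrable_mult_right gauss_integrable_exp_norm) simp
  have "w \<bullet> y \<le> (norm y)\<^sup>2 + 1 / 4 * (norm w)\<^sup>2" for w
    using norm_cauchy_schwarz[of w y] zero_le_power2[of "norm w / 2 - norm y"]
    by (simp add: power2_diff power_divide)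
  thus "AE w in gauss_measure. norm (exp (w \<bullet> y)) \<le>
      norm (exp ((norm y)\<^sup>2) * exp (1 / 4 * (norm w)\<^sup>2))"
    by (intro AE_I2) (simp flip: exp_add)
qed measurable

lemma gauss_integrable_shift_density:
  "integrable gauss_measure (shift_density (y :: real^'d::finite))"
  unfolding shift_density_def[abs_def] exp_diff
  by (intro integrable_divide gauss_integrable_exp_inner)

section \<open>Gaussian shift densities of isotropic laws\<close>

lemma power_le_fact_mult_exp:
  fixes x :: real
  assumes "x \<ge> 0"
  shows "x ^ k \<le> fact k * exp x"
proof -
  obtain t where "exp x = (\<Sum>m<Suc k. x ^ m / fact m) + exp t / fact (Suc k) * x ^ Suc k"
    using Maclaurin_exp_le by blast
  moreover have "x ^ k / fact k \<le> (\<Sum>m<Suc k. x ^ m / fact m)"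
    using assms by (intro member_le_sum[of k _ "\<lambda>m. x ^ m / fact m"]) auto
  moreover have "0 \<le> exp t / fact (Suc k) * x ^ Suc k"
    using assms by (intro mult_nonneg_nonneg) auto
  ultimately have "x ^ k / fact k \<le> exp x" by linarith
  thus ?thesis by (simp add: field_simps)
qed

lemma exp_quadratic_third_order:
  fixes a b \<epsilon> :: real
  assumes "\<epsilon> > 0"
  obtains t where "0 < t" "t < \<epsilon>"
    "exp (\<epsilon> * a - \<epsilon>\<^sup>2 * b / 2) = 1 + \<epsilon> * a + \<epsilon>\<^sup>2 * (a\<^sup>2 - b) / 2 +
      \<epsilon> ^ 3 * (((a - t * b) ^ 3 - 3 * b * (a - t * b)) * exp (t * a - t\<^sup>2 * b / 2)) / 6"
proof -
  define h where "h t = exp (t * a - t\<^sup>2 * b / 2)" for t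
  define D where "D m t =
    ([1, a - t * b, (a - t * b)\<^sup>2 - b, (a - t * b) ^ 3 - 3 * b * (a - t * b)] ! m) * h t"
    for m :: nat and t
  have h: "(h has_real_derivative (a - t * b) * h t) (at t)" for t
    unfolding h_def by (auto intro!: derivative_eq_intros simp: algebra_simps)
  have D: "(D m has_real_derivative D (Suc m) t) (at t)" if "m < 3" for m t
  proof -
    from that consider "m = 0" | "m = 1" | "m = 2" by linarith
    thus ?thesis
    proof cases
      case 1
      thus ?thesis using h by (simp add: D_def[abs_def])
    qed (auto intro!: derivative_eq_intros h
        simp: D_def[abs_def] numeral_2_eq_2 numeral_3_eq_3 algebra_simps)
  qed
  have "\<exists>t>0. t < \<epsilon> \<and> h \<epsilon> = (\<Sum>m<3. D m 0 / fact m * \<epsilon> ^ m) + D 3 t / fact 3 * \<epsilon> ^ 3"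
    by (rule Maclaurin) (use assms D in \<open>auto simp: D_def[of 0]\<close>)
  then obtain t where "0 < t" "t < \<epsilon>"
      "h \<epsilon> = (\<Sum>m<3. D m 0 / fact m * \<epsilon> ^ m) + D 3 t / fact 3 * \<epsilon> ^ 3"
    by blast
  moreover have "(\<Sum>m<3. D m 0 / fact m * \<epsilon> ^ m) = 1 + \<epsilon> * a + \<epsilon>\<^sup>2 * (a\<^sup>2 - b) / 2"
    by (simp add: D_def h_def eval_nat_numeral)
  ultimately show ?thesis
    using that by (simp add: D_def h_def fact_numeral mult_ac)
qed

lemma shift_exponent_le:
  fixes w x :: "'v::real_inner"
  assumes "\<bar>t\<bar> \<le> 1"
  shows "t * (w \<bullet> x) - t\<^sup>2 * (norm x)\<^sup>2 / 2 \<le> ((norm w)\<^sup>2 + (norm x)\<^sup>2) / 3"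
proof -
  define s where "s = \<bar>t\<bar> * norm x"
  have s: "0 \<le> s" "s \<le> norm x"
    using assms by (simp_all add: s_def mult_left_le_one_le)
  have "t * (w \<bullet> x) \<le> norm w * s"
    using Cauchy_Schwarz_ineq2[of w "t *\<^sub>R x"] by (simp add: s_def mult_ac)
  also have "\<dots> \<le> (norm w)\<^sup>2 / 3 + 3 / 4 * s\<^sup>2"
    using zero_le_power2[of "2 * norm w - 3 * s"] by (simp add: power2_diff power_mult_distrib)
  finally have "t * (w \<bullet> x) - s\<^sup>2 / 2 \<le> (norm w)\<^sup>2 / 3 + s\<^sup>2 / 4" by simp
  also have "\<dots> \<le> ((norm w)\<^sup>2 + (norm x)\<^sup>2) / 3"
    using power_mono[OF s(2,1), of 2] zero_le_power2[of "norm x"]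
    unfolding add_divide_distrib by linarith
  finally show ?thesis by (simp add: s_def power_mult_distrib)
qed

text \<open>The exponent exceeds the \<open>1 / 3\<close> of the preceding lemma, to absorb polynomial factors, and is
  less than \<open>1 / 2\<close>, to be integrable with respect to the Gaussian measure.\<close>

definition envelope :: "'v::real_normed_vector \<Rightarrow> real" where
  "envelope w = exp (3 / 8 * (norm w)\<^sup>2)"

lemma envelope_ge_1: "1 \<le> envelope w"
  by (simp add: envelope_def)

lemma envelope_nonneg [simp]: "0 \<le> envelope w"
  by (simp add: envelope_def)

lemma borel_measurable_envelope [measurable]:
  assumes [measurable]: "f \<in> borel_measurable M"
  shows "(\<lambda>x. envelope (f x)) \<in> borel_measurable M"
  unfolding envelope_def by measurable

lemma gauss_integrable_envelope: "integrable gauss_measure (envelope :: real^'d::finite \<Rightarrow> real)"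
  unfolding envelope_def[abs_def] by (rule gauss_integrable_exp_norm) simp

lemma shift_density_le:
  assumes "\<bar>\<epsilon>\<bar> \<le> 1"
  shows "shift_density (\<epsilon> *\<^sub>R x) w \<le> envelope w * envelope x"
proof -
  have "\<epsilon> * (w \<bullet> x) - \<epsilon>\<^sup>2 * (norm x)\<^sup>2 / 2 \<le> 3 / 8 * (norm w)\<^sup>2 + 3 / 8 * (norm x)\<^sup>2"
    using shift_exponent_le[OF assms, of w x] zero_le_power2[of "norm w"]
      zero_le_power2[of "norm x"]
    by argo
  thus ?thesis
    by (simp add: shift_density_def envelope_def power_mult_distrib flip: exp_add)
qed

lemma cubic_le_exp:
  fixes b c S :: real
  assumes "0 \<le> b" "b \<le> S" "\<bar>c\<bar> \<le> 2 * S"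
  shows "\<bar>c ^ 3 - 3 * b * c\<bar> \<le> 720000 * exp (S / 24)"
proof -
  have "\<bar>c ^ 3 - 3 * b * c\<bar> \<le> \<bar>c\<bar> ^ 3 + 3 * b * \<bar>c\<bar>"
    using assms by (intro order_trans[OF abs_triangle_ineq4]) (simp add: abs_mult power_abs)
  also have "\<dots> \<le> (2 * S) ^ 3 + 3 * S * (2 * S)"
    using assms by (intro add_mono power_mono mult_mono) auto
  also have "\<dots> = 8 * 24 ^ 3 * (S / 24) ^ 3 + 6 * 24\<^sup>2 * (S / 24)\<^sup>2"
    by (simp add: power_divide power2_eq_square power_mult_distrib)
  also have "\<dots> \<le> 8 * 24 ^ 3 * (fact 3 * exp (S / 24)) + 6 * 24\<^sup>2 * (fact 2 * exp (S / 24))"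
    using assms by (intro add_mono mult_left_mono power_le_fact_mult_exp) auto
  also have "\<dots> \<le> 720000 * exp (S / 24)"
    by (simp add: fact_numeral)
  finally show ?thesis .
qed

lemma shift_density_third_order:
  fixes w x :: "'v::real_inner"
  assumes \<epsilon>: "0 < \<epsilon>" "\<epsilon> \<le> 1"
  shows "\<bar>shift_density (\<epsilon> *\<^sub>R x) w - (1 + \<epsilon> * (w \<bullet> x) + \<epsilon>\<^sup>2 * ((w \<bullet> x)\<^sup>2 - (norm x)\<^sup>2) / 2)\<bar> \<le>
    120000 * \<epsilon> ^ 3 * (envelope w * envelope x)"
proof -
  define a b S where "a = w \<bullet> x" and "b = (norm x)\<^sup>2" and "S = (norm w)\<^sup>2 + (norm x)\<^sup>2"
  obtain t where t: "0 < t" "t < \<epsilon>" and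
    expansion: "exp (\<epsilon> * a - \<epsilon>\<^sup>2 * b / 2) = 1 + \<epsilon> * a + \<epsilon>\<^sup>2 * (a\<^sup>2 - b) / 2 +
      \<epsilon> ^ 3 * (((a - t * b) ^ 3 - 3 * b * (a - t * b)) * exp (t * a - t\<^sup>2 * b / 2)) / 6"
    using exp_quadratic_third_order[OF \<epsilon>(1)] by blast
  have b: "0 \<le> b" "b \<le> S" by (simp_all add: b_def S_def)
  have "\<bar>a\<bar> \<le> norm w * norm x"
    by (simp add: a_def Cauchy_Schwarz_ineq2)
  also have "\<dots> \<le> S"
    using zero_le_power2[of "norm w - norm x"]
      mult_nonneg_nonneg[OF norm_ge_zero norm_ge_zero, of w x]
    unfolding S_def power2_diff by linarith
  finally have a: "\<bar>a\<bar> \<le> S" .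
  have "t * b \<le> 1 * b" using t \<epsilon> b by (intro mult_right_mono) auto
  moreover have "0 \<le> t * b" using t b by simp
  ultimately have "\<bar>a - t * b\<bar> \<le> 2 * S"
    using a b by linarith
  note polynomial = cubic_le_exp[OF b this]
  have "t * a - t\<^sup>2 * b / 2 \<le> S / 3"
    using shift_exponent_le[of t w x] t \<epsilon> by (simp add: a_def b_def S_def)
  hence "\<bar>((a - t * b) ^ 3 - 3 * b * (a - t * b)) * exp (t * a - t\<^sup>2 * b / 2)\<bar> \<le>
      720000 * exp (S / 24) * exp (S / 3)"
    unfolding abs_mult using polynomial by (intro mult_mono) auto
  also have "\<dots> = 720000 * (envelope w * envelope x)"
    by (simp add: envelope_def S_def algebra_simps flip: exp_add)
  finally have "\<bar>exp (\<epsilon> * a - \<epsilon>\<^sup>2 * b / 2) - (1 + \<epsilon> * a + \<epsilon>\<^sup>2 * (a\<^sup>2 - b) / 2)\<bar> \<le>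
      \<epsilon> ^ 3 * (720000 * (envelope w * envelope x)) / 6"
    using \<epsilon> unfolding expansion by (simp add: abs_mult)
  thus ?thesis
    by (simp add: shift_density_def a_def b_def power_mult_distrib mult_ac)
qed

lemma power2_norm_eq_sum_Basis:
  fixes x :: "'v::euclidean_space"
  shows "(norm x)\<^sup>2 = (\<Sum>b\<in>Basis. (x \<bullet> b)\<^sup>2)"
  unfolding power2_norm_eq_inner by (subst euclidean_inner) (simp add: power2_eq_square)

text \<open>Integrability of \<open>(c \<bullet> x)\<^sup>2\<close> is implied, since a non-integrable function has integral \<open>0\<close>.\<close>

definition isotropic :: "'v::euclidean_space measure \<Rightarrow> bool" where
  "isotropic M \<longleftrightarrow> (\<forall>c. (\<integral>x. c \<bullet> x \<partial>M) = 0) \<and> (\<forall>c. (\<integral>x. (c \<bullet> x)\<^sup>2 \<partial>M) = (norm c)\<^sup>2)"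

lemma isotropicD:
  assumes "isotropic M"
  shows "(\<integral>x. c \<bullet> x \<partial>M) = 0" "(\<integral>x. (c \<bullet> x)\<^sup>2 \<partial>M) = (norm c)\<^sup>2"
  using assms by (simp_all add: isotropic_def)

lemma isotropic_integrable:
  fixes M :: "'v::euclidean_space measure"
  assumes "isotropic M"
  shows "integrable M (\<lambda>x. (c \<bullet> x)\<^sup>2)" and "integrable M (\<lambda>x. (norm x)\<^sup>2)"
proof -
  show int: "integrable M (\<lambda>x. (c \<bullet> x)\<^sup>2)" for c
  proof (cases "c = 0")
    case False
    thus ?thesis
      using isotropicD(2)[OF assms, of c] not_integrable_integral_eq by fastforce
  qed simp
  show "integrable M (\<lambda>x. (norm x)\<^sup>2)"
    using int by (simp add: power2_norm_eq_sum_Basis inner_commute)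
qed

lemma isotropic_integral_power2_norm:
  fixes M :: "'v::euclidean_space measure"
  assumes "isotropic M"
  shows "(\<integral>x. (norm x)\<^sup>2 \<partial>M) = DIM('v)"
  using assms
  by (simp add: power2_norm_eq_sum_Basis inner_commute[of _ "_ :: 'v"]
      isotropic_integrable isotropicD)

lemma isotropic_gauss_measure: "isotropic (gauss_measure :: (real^'d::finite) measure)"
  unfolding isotropic_def
proof (intro conjI allI)
  fix c :: "real^'d"
  show "(\<integral>w. c \<bullet> w \<partial>gauss_measure) = 0"
    by (simp add: inner_vec_def gauss_component_moments)
  have "(c \<bullet> w)\<^sup>2 = (\<Sum>i\<in>UNIV. \<Sum>j\<in>UNIV. c $ i * c $ j * (w $ i * w $ j))" for w
    by (simp add: inner_vec_def power2_eq_square sum_product mult_ac)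
  hence "(\<integral>w. (c \<bullet> w)\<^sup>2 \<partial>gauss_measure) = (\<Sum>i\<in>UNIV. (c $ i)\<^sup>2)"
    by (simp add: gauss_component_moments power2_eq_square if_distrib of_bool_def cong: if_cong)
  thus "(\<integral>w. (c \<bullet> w)\<^sup>2 \<partial>gauss_measure) = (norm c)\<^sup>2"
    by (simp only: power2_norm_vec)
qed

lemma integral_shift_density_isotropic:
  fixes M :: "'v::euclidean_space measure"
  assumes M: "prob_space M" "isotropic M" and [measurable]: "(\<lambda>x. x) \<in> borel_measurable M"
    and int_envelope: "integrable M envelope" and \<epsilon>: "0 < \<epsilon>" "\<epsilon> \<le> 1"
  shows "\<bar>(\<integral>x. shift_density (\<epsilon> *\<^sub>R x) w \<partial>M) - (1 + \<epsilon>\<^sup>2 * ((norm w)\<^sup>2 - DIM('v)) / 2)\<bar> \<le>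
      120000 * \<epsilon> ^ 3 * (envelope w * integral\<^sup>L M envelope)"
proof -
  interpret prob_space M by fact
  define q where "q x = 1 + \<epsilon> * (w \<bullet> x) + \<epsilon>\<^sup>2 * ((w \<bullet> x)\<^sup>2 - (norm x)\<^sup>2) / 2" for x
  have int_inner: "integrable M (\<lambda>x. w \<bullet> x)"
    by (rule square_integrable_imp_integrable) (use isotropic_integrable(1)[OF M(2)] in auto)
  note [simp] = int_inner isotropic_integrable[OF M(2)]
  have int_q: "integrable M q"
    unfolding q_def by simp
  have int: "integrable M (\<lambda>x. shift_density (\<epsilon> *\<^sub>R x) w)"
  proof (rule Bochner_Integration.integrable_bound)
    show "integrable M (\<lambda>x. envelope w * envelope x)"
      using int_envelope by simp
    show "AE x in M. norm (shift_density (\<epsilon> *\<^sub>R x) w) \<le> norm (envelope w * envelope x)"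
      using shift_density_le[of \<epsilon> _ w] \<epsilon> by (intro AE_I2) (simp add: shift_density_def abs_mult)
  qed measurable
  have "(\<integral>x. q x \<partial>M) = 1 + \<epsilon>\<^sup>2 * ((norm w)\<^sup>2 - DIM('v)) / 2"
    unfolding q_def using prob_space
    by (simp add: isotropicD[OF M(2)] isotropic_integral_power2_norm[OF M(2)])
  hence "\<bar>(\<integral>x. shift_density (\<epsilon> *\<^sub>R x) w \<partial>M) - (1 + \<epsilon>\<^sup>2 * ((norm w)\<^sup>2 - DIM('v)) / 2)\<bar> =
      \<bar>\<integral>x. shift_density (\<epsilon> *\<^sub>R x) w - q x \<partial>M\<bar>"
    using int int_q by simp
  also have "\<dots> \<le> (\<integral>x. \<bar>shift_density (\<epsilon> *\<^sub>R x) w - q x\<bar> \<partial>M)"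
    by (rule integral_abs_bound)
  also have "\<dots> \<le> (\<integral>x. 120000 * \<epsilon> ^ 3 * (envelope w * envelope x) \<partial>M)"
    using int int_q int_envelope shift_density_third_order[OF \<epsilon>, of _ w]
    by (intro integral_mono) (auto simp: q_def)
  also have "\<dots> = 120000 * \<epsilon> ^ 3 * (envelope w * integral\<^sup>L M envelope)"
    by simp
  finally show "\<bar>(\<integral>x. shift_density (\<epsilon> *\<^sub>R x) w \<partial>M) - (1 + \<epsilon>\<^sup>2 * ((norm w)\<^sup>2 - DIM('v)) / 2)\<bar> \<le>
      120000 * \<epsilon> ^ 3 * (envelope w * integral\<^sup>L M envelope)" .
qed

section \<open>Exchanging one step for a Gaussian one\<close>

lemma integrable_mult_bounded:
  fixes f g :: "'a \<Rightarrow> real"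
  assumes "integrable M f" "g \<in> borel_measurable M" "\<And>x. \<bar>g x\<bar> \<le> 1"
  shows "integrable M (\<lambda>x. f x * g x)"
proof (rule Bochner_Integration.integrable_bound[OF assms(1)])
  show "AE x in M. norm (f x * g x) \<le> norm (f x)"
    using assms(3) by (intro AE_I2) (auto simp: abs_mult mult_left_le)
qed (use assms in measurable)

lemma expectation_pmf_integral_swap:
  fixes f :: "'a \<Rightarrow> 'b \<Rightarrow> real"
  assumes "finite (set_pmf P)" "\<And>x. x \<in> set_pmf P \<Longrightarrow> integrable M (f x)"
  shows "integrable M (\<lambda>w. measure_pmf.expectation P (\<lambda>x. f x w))"
    and "measure_pmf.expectation P (\<lambda>x. \<integral>w. f x w \<partial>M) =
      (\<integral>w. measure_pmf.expectation P (\<lambda>x. f x w) \<partial>M)"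
  using assms by (simp_all add: integral_measure_pmf[of "set_pmf P"])

definition exchange_const :: "(real^'d::finite) pmf \<Rightarrow> real" where
  "exchange_const P = 120000 *
     (measure_pmf.expectation P envelope + integral\<^sup>L (gauss_measure :: (real^'d) measure) envelope)"

lemma exchange_const_nonneg: "0 \<le> exchange_const P"
  by (simp add: exchange_const_def Bochner_Integration.integral_nonneg)

text \<open>Both laws are isotropic, so their mean shift densities agree up to second order in \<open>\<epsilon>\<close>.\<close>

lemma shift_density_exchange:
  fixes P :: "(real^'d::finite) pmf"
  assumes fin: "finite (set_pmf P)" and iso: "isotropic (measure_pmf P)" and \<epsilon>: "0 < \<epsilon>" "\<epsilon> \<le> 1"
  shows "\<bar>measure_pmf.expectation P (\<lambda>x. shift_density (\<epsilon> *\<^sub>R x) w)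
      - (\<integral>x. shift_density (\<epsilon> *\<^sub>R x) w \<partial>gauss_measure)\<bar> \<le>
    exchange_const P * \<epsilon> ^ 3 * envelope w"
proof -
  have "\<bar>measure_pmf.expectation P (\<lambda>x. shift_density (\<epsilon> *\<^sub>R x) w)
      - (1 + \<epsilon>\<^sup>2 * ((norm w)\<^sup>2 - DIM(real^'d)) / 2)\<bar> \<le>
      120000 * \<epsilon> ^ 3 * (envelope w * measure_pmf.expectation P envelope)"
    by (intro integral_shift_density_isotropic prob_space_measure_pmf iso \<epsilon>
        integrable_measure_pmf_finite fin) simp
  moreover have "\<bar>(\<integral>x. shift_density (\<epsilon> *\<^sub>R x) w \<partial>gauss_measure)
      - (1 + \<epsilon>\<^sup>2 * ((norm w)\<^sup>2 - DIM(real^'d)) / 2)\<bar> \<le>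
      120000 * \<epsilon> ^ 3 * (envelope w * integral\<^sup>L (gauss_measure :: (real^'d) measure) envelope)"
    by (intro integral_shift_density_isotropic prob_space_gauss_measure isotropic_gauss_measure \<epsilon>
        gauss_integrable_envelope) simp
  ultimately show ?thesis by (simp add: exchange_const_def algebra_simps)
qed

lemma gaussian_exchange:
  fixes P :: "(real^'d::finite) pmf" and F :: "real^'d \<Rightarrow> real"
  assumes fin: "finite (set_pmf P)" and iso: "isotropic (measure_pmf P)"
    and F [measurable]: "F \<in> borel_measurable borel" and F_le: "\<And>w. \<bar>F w\<bar> \<le> 1"
    and \<epsilon>: "0 < \<epsilon>" "\<epsilon> \<le> 1"
  shows "\<bar>measure_pmf.expectation P (\<lambda>x. \<integral>w. F (w + \<epsilon> *\<^sub>R x) \<partial>gauss_measure)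
      - (\<integral>w. F (sqrt (1 + \<epsilon>\<^sup>2) *\<^sub>R w) \<partial>gauss_measure)\<bar> \<le>
    exchange_const P * \<epsilon> ^ 3 * (\<integral>w. envelope w * \<bar>F w\<bar> \<partial>gauss_measure)"
proof -
  define \<pi> where "\<pi> w = measure_pmf.expectation P (\<lambda>x. shift_density (\<epsilon> *\<^sub>R x) w)" for w
  define \<phi> where "\<phi> w = (\<integral>x. shift_density (\<epsilon> *\<^sub>R x) w \<partial>gauss_measure)" for w :: "real^'d"
  define C where "C = exchange_const P * \<epsilon> ^ 3"
  have int_shift: "integrable gauss_measure (\<lambda>w. shift_density (\<epsilon> *\<^sub>R x) w * F w)" for x
    by (intro integrable_mult_bounded gauss_integrable_shift_density F_le) simp
  have \<pi>: "measure_pmf.expectation P (\<lambda>x. \<integral>w. F (w + \<epsilon> *\<^sub>R x) \<partial>gauss_measure) =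
      (\<integral>w. \<pi> w * F w \<partial>gauss_measure)"
    and int_\<pi>: "integrable gauss_measure (\<lambda>w. \<pi> w * F w)"
    using expectation_pmf_integral_swap[OF fin int_shift]
    by (simp_all add: gauss_integral_shift \<pi>_def integrable_measure_pmf_finite[OF fin])
  have difference: "\<bar>\<pi> w * F w - \<phi> w * F w\<bar> \<le> C * (envelope w * \<bar>F w\<bar>)" for w
    using mult_right_mono[OF shift_density_exchange[OF fin iso \<epsilon>, of w], of "\<bar>F w\<bar>"]
    unfolding left_diff_distrib[symmetric] abs_mult by (simp add: \<pi>_def \<phi>_def C_def mult_ac)
  have int_bound: "integrable gauss_measure (\<lambda>w. C * (envelope w * \<bar>F w\<bar>))"
    by (intro integrable_mult_right integrable_mult_bounded gauss_integrable_envelope)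
      (use F_le in auto)
  have [measurable]: "\<phi> \<in> borel_measurable borel"
    unfolding \<phi>_def gauss_integral_shift_density by measurable
  have int_diff: "integrable gauss_measure (\<lambda>w. \<pi> w * F w - \<phi> w * F w)"
  proof (rule Bochner_Integration.integrable_bound[OF int_bound])
    show "AE w in gauss_measure. norm (\<pi> w * F w - \<phi> w * F w) \<le> norm (C * (envelope w * \<bar>F w\<bar>))"
      using difference by (intro AE_I2) (metis abs_ge_self order_trans real_norm_def)
  qed (use int_\<pi> in measurable)
  have "(\<integral>w. \<pi> w * F w \<partial>gauss_measure) - (\<integral>w. \<phi> w * F w \<partial>gauss_measure) =
      (\<integral>w. \<pi> w * F w - \<phi> w * F w \<partial>gauss_measure)"
    using Bochner_Integration.integrable_diff[OF int_\<pi> int_diff] int_\<pi> by simp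
  also have "\<bar>\<dots>\<bar> \<le> (\<integral>w. \<bar>\<pi> w * F w - \<phi> w * F w\<bar> \<partial>gauss_measure)"
    by (rule integral_abs_bound)
  also have "\<dots> \<le> (\<integral>w. C * (envelope w * \<bar>F w\<bar>) \<partial>gauss_measure)"
    using difference int_diff int_bound by (intro integral_mono) auto
  finally show ?thesis
    by (simp add: \<pi> gauss_integral_convolution \<phi>_def C_def)
qed

definition boundary_nbhd :: "'v::real_normed_vector set \<Rightarrow> real \<Rightarrow> 'v set" where
  "boundary_nbhd B r = {u. \<exists>v. norm v \<le> r \<and> (u + v \<in> B) \<noteq> (u \<in> B)}"

lemma boundary_nbhd_mono: "r \<le> s \<Longrightarrow> boundary_nbhd B r \<subseteq> boundary_nbhd B s"
  by (force simp: boundary_nbhd_def)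

lemma indicator_translate_diff_le:
  "\<bar>indicat_real B (u + v) - indicat_real B u\<bar> \<le> indicat_real (boundary_nbhd B (norm v)) u"
  by (auto simp: boundary_nbhd_def indicator_def)

lemma borel_measurable_indicator_boundary_nbhd [measurable]:
  assumes [measurable]: "f \<in> borel_measurable M"
  shows "(\<lambda>w. indicat_real (boundary_nbhd B (f w)) u) \<in> borel_measurable M"
proof -
  have "mono (\<lambda>r. indicat_real (boundary_nbhd B r) u)"
    using boundary_nbhd_mono by (fastforce simp: mono_def indicator_def)
  hence "(\<lambda>r. indicat_real (boundary_nbhd B r) u) \<in> borel_measurable borel"
    by (rule borel_measurable_mono)
  thus ?thesis by (rule measurable_compose[OF assms])
qed

definition gauss_smoothing :: "(real^'d::finite) set \<Rightarrow> nat \<Rightarrow> real^'d \<Rightarrow> real" where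
  "gauss_smoothing B m u = (\<integral>w. indicator B (u + sqrt (real m) *\<^sub>R w) \<partial>gauss_measure)"

definition boundary_weight :: "(real^'d::finite) set \<Rightarrow> real \<Rightarrow> real^'d \<Rightarrow> real" where
  "boundary_weight B s u =
     (\<integral>w. envelope w * indicator (boundary_nbhd B (s * norm w)) u
        \<partial>(gauss_measure :: (real^'d) measure))"

lemma integrable_boundary_weight:
  "integrable gauss_measure
     (\<lambda>w::real^'d::finite. envelope w * indicat_real (boundary_nbhd B (s * norm w)) u)"
  by (intro integrable_mult_bounded gauss_integrable_envelope) (auto simp: indicator_abs_le_1)

lemma gauss_smoothing_0 [simp]: "gauss_smoothing B 0 = indicator B"
  by (simp add: fun_eq_iff gauss_smoothing_def)

definition exchange_error :: "(real^'d::finite) pmf \<Rightarrow> (real^'d) set \<Rightarrow> nat \<Rightarrow> real^'d \<Rightarrow> real" where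
  "exchange_error P B m u =
     measure_pmf.expectation P (\<lambda>x. gauss_smoothing B m (u + x)) - gauss_smoothing B (Suc m) u"

lemma exchange_error_Suc_le:
  fixes P :: "(real^'d::finite) pmf"
  assumes fin: "finite (set_pmf P)" and iso: "isotropic (measure_pmf P)"
    and B [measurable]: "B \<in> sets borel" and m: "m > 0"
  shows "\<bar>exchange_error P B m u\<bar> \<le>
    exchange_const P / (real m * sqrt (real m)) * boundary_weight B (sqrt (real m)) u"
proof -
  define \<epsilon> where "\<epsilon> = 1 / sqrt (real m)"
  define F where "F w = indicat_real B (u + sqrt (real m) *\<^sub>R w) - indicat_real B u" for w
  have \<epsilon>: "0 < \<epsilon>" "\<epsilon> \<le> 1" "\<epsilon> ^ 3 = 1 / (real m * sqrt (real m))"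
    using m by (auto simp: \<epsilon>_def power3_eq_cube)
  have F [measurable]: "F \<in> borel_measurable borel"
    unfolding F_def by measurable
  have F_le: "\<bar>F w\<bar> \<le> indicat_real (boundary_nbhd B (sqrt (real m) * norm w)) u" for w
    using indicator_translate_diff_le[of B u "sqrt (real m) *\<^sub>R w"] by (simp add: F_def)
  have int: "integrable gauss_measure (\<lambda>w. indicat_real B (v + r *\<^sub>R w))" for v r
    by (rule gauss.integrable_const_bound[of _ 1]) (auto simp: indicator_def)
  have smoothing_shift: "(\<integral>w. F (w + \<epsilon> *\<^sub>R x) \<partial>gauss_measure) =
      gauss_smoothing B m (u + x) - indicator B u" for x
    using m int[of "u + x" "sqrt (real m)"]
    by (simp add: F_def \<epsilon>_def gauss_smoothing_def scaleR_add_right add_ac)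
  have "sqrt (real m) * sqrt (1 + \<epsilon>\<^sup>2) = sqrt (real (Suc m))"
    using m by (simp add: \<epsilon>_def power_divide distrib_left flip: real_sqrt_mult)
  hence smoothing_scale: "(\<integral>w. F (sqrt (1 + \<epsilon>\<^sup>2) *\<^sub>R w) \<partial>gauss_measure) =
      gauss_smoothing B (Suc m) u - indicator B u"
    using int[of u "sqrt (real (Suc m))"] by (simp add: F_def gauss_smoothing_def)
  have "\<bar>exchange_error P B m u\<bar> \<le>
      exchange_const P * \<epsilon> ^ 3 * (\<integral>w. envelope w * \<bar>F w\<bar> \<partial>gauss_measure)"
    using gaussian_exchange[OF fin iso F _ \<epsilon>(1,2)] F_le
    by (simp add: exchange_error_def smoothing_shift smoothing_scale
        integrable_measure_pmf_finite[OF fin])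
       (metis indicator_le_1 order_trans)
  also have "\<dots> \<le> exchange_const P * \<epsilon> ^ 3 * boundary_weight B (sqrt (real m)) u"
    unfolding boundary_weight_def
  proof (intro mult_left_mono integral_mono integrable_boundary_weight F_le)
    show "integrable gauss_measure (\<lambda>w. envelope w * \<bar>F w\<bar>)"
      by (intro integrable_mult_bounded gauss_integrable_envelope)
         (use F_le in \<open>auto intro: order_trans[OF _ indicator_le_1]\<close>)
  qed (use \<epsilon>(1) in \<open>auto intro!: mult_nonneg_nonneg exchange_const_nonneg\<close>)
  finally show ?thesis by (simp add: \<epsilon>(3))
qed

lemma exchange_error_0_le:
  fixes P :: "(real^'d::finite) pmf"
  assumes fin: "finite (set_pmf P)" and M: "\<And>x. x \<in> set_pmf P \<Longrightarrow> norm x \<le> M"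
    and [measurable]: "B \<in> sets borel"
  shows "\<bar>exchange_error P B 0 u\<bar> \<le>
    indicat_real (boundary_nbhd B M) u + boundary_weight B 1 u"
proof -
  note [simp] = integrable_measure_pmf_finite[OF fin]
  have int: "integrable gauss_measure (\<lambda>w. indicat_real B (u + w))"
    by (rule gauss.integrable_const_bound[of _ 1]) (auto simp: indicator_def)
  have "\<bar>measure_pmf.expectation P (\<lambda>x. indicat_real B (u + x)) - indicat_real B u\<bar> =
      \<bar>measure_pmf.expectation P (\<lambda>x. indicat_real B (u + x) - indicat_real B u)\<bar>"
    by simp
  also have "\<dots> \<le> measure_pmf.expectation P (\<lambda>x. \<bar>indicat_real B (u + x) - indicat_real B u\<bar>)"
    by (rule integral_abs_bound)
  also have "\<dots> \<le> measure_pmf.expectation P (\<lambda>_. indicat_real (boundary_nbhd B M) u)"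
    using boundary_nbhd_mono[OF M, of _ B]
    by (intro expectation_pmf_mono fin order_trans[OF indicator_translate_diff_le]
        indicator_leI) auto
  finally have walk_step:
    "\<bar>measure_pmf.expectation P (\<lambda>x. indicat_real B (u + x)) - indicat_real B u\<bar> \<le>
      indicat_real (boundary_nbhd B M) u" by simp
  have "\<bar>gauss_smoothing B (Suc 0) u - indicat_real B u\<bar> =
      \<bar>\<integral>w. indicat_real B (u + w) - indicat_real B u \<partial>gauss_measure\<bar>"
    using int by (simp add: gauss_smoothing_def)
  also have "\<dots> \<le> (\<integral>w. \<bar>indicat_real B (u + w) - indicat_real B u\<bar> \<partial>gauss_measure)"
    by (rule integral_abs_bound)
  also have "\<dots> \<le> boundary_weight B 1 u"
    unfolding boundary_weight_def
  proof (rule integral_mono[OF _ integrable_boundary_weight])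
    show "integrable gauss_measure (\<lambda>w. \<bar>indicat_real B (u + w) - indicat_real B u\<bar>)"
      using int by simp
    fix w :: "real^'d"
    have "1 * indicat_real (boundary_nbhd B (norm w)) u \<le>
        envelope w * indicat_real (boundary_nbhd B (norm w)) u"
      by (intro mult_right_mono envelope_ge_1) simp
    thus "\<bar>indicat_real B (u + w) - indicat_real B u\<bar> \<le>
        envelope w * indicat_real (boundary_nbhd B (1 * norm w)) u"
      using indicator_translate_diff_le[of B u w] by simp
  qed
  finally show ?thesis using walk_step by (simp add: exchange_error_def)
qed

section \<open>Berry-Esseen bounds for isotropic walks\<close>

definition boundary_moment :: "'d::finite itself \<Rightarrow> real" where
  "boundary_moment _ =
     (\<integral>w. envelope w * (norm w + 1) \<partial>(gauss_measure :: (real^'d) measure))"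

lemma integrable_boundary_moment:
  "integrable gauss_measure (\<lambda>w::real^'d::finite. envelope w * (norm w + 1))"
proof (rule Bochner_Integration.integrable_bound)
  show "integrable gauss_measure (\<lambda>w::real^'d. 5 * exp (7 / 16 * (norm w)\<^sup>2))"
    by (intro integrable_mult_right gauss_integrable_exp_norm) simp
  have "envelope w * (norm w + 1) \<le> 5 * exp (7 / 16 * (norm w)\<^sup>2)" for w :: "real^'d"
  proof -
    have "norm w + 1 \<le> 5 * (1 + (norm w)\<^sup>2 / 16)"
      using zero_le_power2[of "5 * norm w / 8 - 1"] zero_le_power2[of "norm w"]
      by (simp add: power2_diff power_divide)
    also have "\<dots> \<le> 5 * exp ((norm w)\<^sup>2 / 16)"
      by (intro mult_left_mono) auto
    finally have "envelope w * (norm w + 1) \<le> envelope w * (5 * exp ((norm w)\<^sup>2 / 16))"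
      by (intro mult_left_mono) simp_all
    also have "\<dots> = 5 * exp (7 / 16 * (norm w)\<^sup>2)"
      by (simp add: envelope_def flip: exp_add)
    finally show ?thesis .
  qed
  thus "AE w in gauss_measure. norm (envelope w * (norm w + 1)) \<le>
      norm (5 * exp (7 / 16 * (norm (w :: real^'d))\<^sup>2))"
    by (intro AE_I2) (simp add: abs_mult)
qed measurable

lemma boundary_moment_nonneg: "0 \<le> boundary_moment TYPE('d::finite)"
  by (simp add: boundary_moment_def Bochner_Integration.integral_nonneg)

lemma expectation_boundary_weight_le:
  fixes W :: "(real^'d::finite) pmf"
  assumes fin: "finite (set_pmf W)"
    and thin: "\<And>r. r \<ge> 0 \<Longrightarrow> measure_pmf.prob W (boundary_nbhd B r) \<le> D * (r + 1)"
    and s: "s \<ge> 1"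
  shows "measure_pmf.expectation W (boundary_weight B s) \<le> D * s * boundary_moment TYPE('d)"
proof -
  have "0 \<le> D"
    using order_trans[OF measure_nonneg thin[of 0]] by simp
  let ?weight = "\<lambda>u (w :: real^'d). envelope w * indicat_real (boundary_nbhd B (s * norm w)) u"
  note swap = expectation_pmf_integral_swap[OF fin, of gauss_measure ?weight,
      OF integrable_boundary_weight]
  have "measure_pmf.expectation W (boundary_weight B s) =
      (\<integral>w. measure_pmf.expectation W (\<lambda>u. ?weight u w) \<partial>gauss_measure)"
    unfolding boundary_weight_def by (rule swap(2))
  also have "\<dots> \<le> (\<integral>w. D * s * (envelope w * (norm (w :: real^'d) + 1)) \<partial>gauss_measure)"
  proof (intro integral_mono swap(1) integrable_mult_right integrable_boundary_moment)
    fix w :: "real^'d"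
    have "measure_pmf.prob W (boundary_nbhd B (s * norm w)) \<le> D * (s * norm w + 1)"
      using s by (intro thin) simp
    also have "\<dots> \<le> D * (s * (norm w + 1))"
      using s \<open>0 \<le> D\<close> by (intro mult_left_mono) (auto simp: distrib_left)
    finally have "envelope w * measure_pmf.prob W (boundary_nbhd B (s * norm w)) \<le>
        envelope w * (D * (s * (norm w + 1)))"
      by (intro mult_left_mono) auto
    thus "measure_pmf.expectation W (\<lambda>u. ?weight u w) \<le> D * s * (envelope w * (norm w + 1))"
      by (simp add: mult_ac)
  qed
  also have "\<dots> = D * s * boundary_moment TYPE('d)"
    by (simp add: boundary_moment_def)
  finally show ?thesis .
qed

lemma sqrt_add_divide_le:
  fixes m k :: real
  assumes "m > 0" "k > 0"
  shows "sqrt (m + k) / (m * sqrt k) \<le> 3 / 2 * (1 / m) + 1 / 2 * (1 / k)"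
proof -
  define a b where "a = sqrt m" and "b = sqrt k"
  have pos: "a > 0" "b > 0" using assms by (auto simp: a_def b_def)
  have sq: "m = a\<^sup>2" "k = b\<^sup>2" using assms by (auto simp: a_def b_def)
  have "sqrt (m + k) / (m * sqrt k) \<le> (a + b) / (m * sqrt k)"
    using assms sqrt_add_le_add_sqrt[of m k] by (intro divide_right_mono) (auto simp: a_def b_def)
  also have "\<dots> = 1 / a\<^sup>2 + (1 / a) * (1 / b)"
    using pos by (simp add: sq field_simps power2_eq_square real_sqrt_mult)
  also have "(1 / a) * (1 / b) \<le> ((1 / a)\<^sup>2 + (1 / b)\<^sup>2) / 2"
    using zero_le_power2[of "1 / a - 1 / b"] by (simp add: power2_diff)
  finally show ?thesis
    by (simp add: sq power_divide add_divide_distrib)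
qed

lemma harm_le_one_plus_ln:
  assumes "n > 0"
  shows "(harm n :: real) \<le> 1 + ln (real n)"
proof -
  obtain k where n: "n = Suc k" using assms by (cases n) auto
  have "harm (Suc k) - ln (real (Suc k)) \<le> harm (Suc 0) - ln (real (Suc 0))"
    using decseqD[OF decseq_harm_diff_ln, of 0 k] by simp
  thus ?thesis by (simp add: n harm_expand)
qed

lemma sum_inverse_mult_sqrt_le:
  "(\<Sum>k<N. 1 / (real (N - k) * sqrt (real k + 1))) \<le>
    2 * (1 + ln (real (Suc N))) / sqrt (real (Suc N))"
proof (rule mult_imp_le_div_pos)
  have "(\<Sum>k<N. 1 / (real (N - k) * sqrt (real k + 1))) * sqrt (real (Suc N)) \<le>
      (\<Sum>k<N. 3 / 2 * (1 / real (N - k)) + 1 / 2 * (1 / (real k + 1)))"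
    unfolding sum_distrib_right
  proof (intro sum_mono)
    fix k assume "k \<in> {..<N}"
    hence "real (N - k) + (real k + 1) = real (Suc N)" "real (N - k) > 0" by auto
    thus "1 / (real (N - k) * sqrt (real k + 1)) * sqrt (real (Suc N)) \<le>
        3 / 2 * (1 / real (N - k)) + 1 / 2 * (1 / (real k + 1))"
      using sqrt_add_divide_le[of "real (N - k)" "real k + 1"]
      by (simp only: times_divide_eq_left mult_1_left)
  qed
  also have "\<dots> = 3 / 2 * (\<Sum>k<N. 1 / real (N - k)) + 1 / 2 * (\<Sum>k<N. 1 / (real k + 1))"
    by (simp add: sum.distrib sum_distrib_left)
  also have "(\<Sum>k<N. 1 / real (N - k)) = (\<Sum>k<N. 1 / (real k + 1))"
    by (subst sum.nat_diff_reindex[symmetric])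
       (intro sum.cong refl, auto simp: Suc_diff_Suc of_nat_diff)
  also have "(\<Sum>k<N. 1 / (real k + 1)) = harm N"
    by (simp add: harm_altdef inverse_eq_divide add.commute)
  also have "3 / 2 * harm N + 1 / 2 * harm N \<le> 2 * (1 + ln (real (Suc N)))"
    using harm_mono[of N "Suc N", where ?'a = real] harm_le_one_plus_ln[of "Suc N"] by simp
  finally show "(\<Sum>k<N. 1 / (real (N - k) * sqrt (real k + 1))) * sqrt (real (Suc N)) \<le>
      2 * (1 + ln (real (Suc N)))" .
qed simp

lemma expectation_exchange_error_le:
  fixes P W :: "(real^'d::finite) pmf"
  assumes fin: "finite (set_pmf P)" "finite (set_pmf W)" and iso: "isotropic (measure_pmf P)"
    and B: "B \<in> sets borel" and m: "m > 0"
    and thin: "\<And>r. r \<ge> 0 \<Longrightarrow> measure_pmf.prob W (boundary_nbhd B r) \<le> D * (r + 1)"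
  shows "\<bar>measure_pmf.expectation W (exchange_error P B m)\<bar> \<le>
    exchange_const P * boundary_moment TYPE('d) * (D / real m)"
proof -
  define c where "c = exchange_const P / (real m * sqrt (real m))"
  have "\<bar>measure_pmf.expectation W (exchange_error P B m)\<bar> \<le>
      measure_pmf.expectation W (\<lambda>u. \<bar>exchange_error P B m u\<bar>)"
    by (rule integral_abs_bound)
  also have "\<dots> \<le> measure_pmf.expectation W (\<lambda>u. c * boundary_weight B (sqrt (real m)) u)"
    unfolding c_def by (intro expectation_pmf_mono fin exchange_error_Suc_le iso B m)
  also have "\<dots> = c * measure_pmf.expectation W (boundary_weight B (sqrt (real m)))"
    by simp
  also have "\<dots> \<le> c * (D * sqrt (real m) * boundary_moment TYPE('d))"
    using m by (intro mult_left_mono expectation_boundary_weight_le fin thin)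
      (auto simp: c_def exchange_const_nonneg)
  also have "\<dots> = exchange_const P * boundary_moment TYPE('d) * (D / real m)"
    using m by (simp add: c_def)
  finally show ?thesis .
qed

lemma expectation_exchange_error_0_le:
  fixes P W :: "(real^'d::finite) pmf"
  assumes fin: "finite (set_pmf P)" "finite (set_pmf W)"
    and M: "\<And>x. x \<in> set_pmf P \<Longrightarrow> norm x \<le> M" and B: "B \<in> sets borel"
    and thin: "\<And>r. r \<ge> 0 \<Longrightarrow> measure_pmf.prob W (boundary_nbhd B r) \<le> D * (r + 1)"
  shows "\<bar>measure_pmf.expectation W (exchange_error P B 0)\<bar> \<le>
    (M + 1 + boundary_moment TYPE('d)) * D"
proof -
  obtain x where "x \<in> set_pmf P" using set_pmf_not_empty by fast
  hence "M \<ge> 0" using M norm_ge_zero order_trans by blast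
  have "\<bar>measure_pmf.expectation W (exchange_error P B 0)\<bar> \<le>
      measure_pmf.expectation W (\<lambda>u. \<bar>exchange_error P B 0 u\<bar>)"
    by (rule integral_abs_bound)
  also have "\<dots> \<le>
      measure_pmf.expectation W (\<lambda>u. indicat_real (boundary_nbhd B M) u + boundary_weight B 1 u)"
    by (intro expectation_pmf_mono fin exchange_error_0_le M B)
  also have "\<dots> =
      measure_pmf.prob W (boundary_nbhd B M) + measure_pmf.expectation W (boundary_weight B 1)"
    by (simp add: integrable_measure_pmf_finite fin)
  also have "\<dots> \<le> D * (M + 1) + D * 1 * boundary_moment TYPE('d)"
    using \<open>M \<ge> 0\<close> by (intro add_mono thin expectation_boundary_weight_le fin) auto
  finally show ?thesis by (simp add: algebra_simps)
qed

lemma prob_walk_diff_gauss_eq_sum: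
  fixes P :: "(real^'d::finite) pmf"
  assumes fin: "finite (set_pmf P)" and [measurable]: "B \<in> sets borel"
  shows "measure_pmf.prob (walk_pmf P n) B - measure gauss_measure {w. sqrt (real n) *\<^sub>R w \<in> B} =
    (\<Sum>k<n. measure_pmf.expectation (walk_pmf P k) (exchange_error P B (n - Suc k)))"
proof -
  define a where "a k = measure_pmf.expectation (walk_pmf P k) (gauss_smoothing B (n - k))" for k
  have "a (Suc k) - a k = measure_pmf.expectation (walk_pmf P k) (exchange_error P B (n - Suc k))"
    if "k < n" for k
    using that
    by (simp add: a_def exchange_error_def[abs_def] expectation_walk_Suc[OF fin] Suc_diff_Suc
        integrable_measure_pmf_finite finite_set_pmf_walk fin)
  hence "(\<Sum>k<n. measure_pmf.expectation (walk_pmf P k) (exchange_error P B (n - Suc k))) =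
      a n - a 0"
    by (simp flip: sum_lessThan_telescope)
  moreover have "a n = measure_pmf.prob (walk_pmf P n) B"
    by (simp add: a_def)
  moreover have "{w. sqrt (real n) *\<^sub>R w \<in> B} \<in> sets borel"
    by measurable
  hence "a 0 = measure gauss_measure {w. sqrt (real n) *\<^sub>R w \<in> B}"
    by (simp add: a_def gauss_smoothing_def indicator_vimage[symmetric] vimage_def)
  ultimately show ?thesis by simp
qed

theorem berry_esseen_thin_boundary:
  fixes P :: "(real^'d::finite) pmf"
  assumes fin: "finite (set_pmf P)" and iso: "isotropic (measure_pmf P)"
    and M: "\<And>x. x \<in> set_pmf P \<Longrightarrow> norm x \<le> M" and B: "B \<in> sets borel" and n: "n > 0"
    and thin: "\<And>k r. r \<ge> 0 \<Longrightarrow>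
      measure_pmf.prob (walk_pmf P k) (boundary_nbhd B r) \<le> D * (r + 1) / sqrt (real k + 1)"
  shows "\<bar>measure_pmf.prob (walk_pmf P n) B - measure gauss_measure {w. sqrt (real n) *\<^sub>R w \<in> B}\<bar> \<le>
    (M + 1 + (1 + 2 * exchange_const P) * boundary_moment TYPE('d)) * D *
      (1 + ln (real n)) / sqrt (real n)"
proof -
  define J where "J = boundary_moment TYPE('d)"
  define K where "K = exchange_const P"
  define e where "e k m = measure_pmf.expectation (walk_pmf P k) (exchange_error P B m)" for k m
  define l where "l = 1 + ln (real n)"
  obtain N where N: "n = Suc N" using n by (cases n) auto
  have thin': "measure_pmf.prob (walk_pmf P k) (boundary_nbhd B r) \<le>
      D / sqrt (real k + 1) * (r + 1)"
    if "r \<ge> 0" for k r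
    using thin[OF that] by simp
  have e_pos: "\<bar>e k m\<bar> \<le> K * J * D * (1 / (real m * sqrt (real k + 1)))" if "m > 0" for k m
    using expectation_exchange_error_le[OF fin finite_set_pmf_walk[OF fin] iso B that thin', of k]
    by (simp add: e_def K_def J_def mult_ac)
  have e_0: "\<bar>e k 0\<bar> \<le> (M + 1 + J) * D / sqrt (real k + 1)" for k
    using expectation_exchange_error_0_le[OF fin finite_set_pmf_walk[OF fin] M B thin', of k]
    by (simp add: e_def J_def)
  have "0 \<le> K * J * D"
    using order_trans[OF measure_nonneg thin[of 0 0]]
    by (simp add: J_def K_def boundary_moment_nonneg exchange_const_nonneg)
  have "0 \<le> (M + 1 + J) * D"
    using order_trans[OF abs_ge_zero e_0[of 0]] by simp
  have "\<bar>measure_pmf.prob (walk_pmf P n) B - measure gauss_measure {w. sqrt (real n) *\<^sub>R w \<in> B}\<bar> =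
      \<bar>(\<Sum>k<N. e k (N - k)) + e N 0\<bar>"
    using prob_walk_diff_gauss_eq_sum[OF fin B, of n] by (simp add: e_def N)
  also have "\<dots> \<le> (\<Sum>k<N. \<bar>e k (N - k)\<bar>) + \<bar>e N 0\<bar>"
    by (intro order_trans[OF abs_triangle_ineq] add_right_mono sum_abs)
  also have "\<dots> \<le> (\<Sum>k<N. K * J * D * (1 / (real (N - k) * sqrt (real k + 1)))) +
      (M + 1 + J) * D / sqrt (real N + 1)"
    by (intro add_mono sum_mono e_pos e_0) auto
  also have "\<dots> \<le> K * J * D * (2 * l / sqrt (real n)) + (M + 1 + J) * D * l / sqrt (real n)"
  proof (intro add_mono)
    show "(\<Sum>k<N. K * J * D * (1 / (real (N - k) * sqrt (real k + 1)))) \<le>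
        K * J * D * (2 * l / sqrt (real n))"
      unfolding sum_distrib_left[symmetric] N l_def using \<open>0 \<le> K * J * D\<close>
      by (intro mult_left_mono sum_inverse_mult_sqrt_le)
    show "(M + 1 + J) * D / sqrt (real N + 1) \<le> (M + 1 + J) * D * l / sqrt (real n)"
      using mult_left_mono[OF _ \<open>0 \<le> (M + 1 + J) * D\<close>, of 1 l]
      by (simp add: N l_def divide_right_mono add.commute)
  qed
  also have "\<dots> = (M + 1 + (1 + 2 * K) * J) * D * l / sqrt (real n)"
    by (simp add: algebra_simps add_divide_distrib)
  finally show ?thesis by (simp add: K_def J_def l_def)
qed

lemma boundary_nbhd_orthant_subset:
  fixes A :: "real^'d::finite^'e::finite"
  shows "boundary_nbhd {u. c \<le> A *v u} r \<subseteq>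
    (\<Union>t\<in>{t. A $ t \<noteq> 0}. {u. \<bar>A $ t \<bullet> u - c $ t\<bar> \<le> norm (A $ t) * r})"
proof
  fix u assume "u \<in> boundary_nbhd {u. c \<le> A *v u} r"
  then obtain v where v: "norm v \<le> r" "(c \<le> A *v (u + v)) \<noteq> (c \<le> A *v u)"
    by (auto simp: boundary_nbhd_def)
  then obtain t where t: "(c $ t \<le> A $ t \<bullet> u + A $ t \<bullet> v) \<noteq> (c $ t \<le> A $ t \<bullet> u)"
    by (auto simp: less_eq_vec_def matrix_vector_mul_component inner_add_right)
  hence "A $ t \<noteq> 0" by auto
  have "\<bar>A $ t \<bullet> u - c $ t\<bar> \<le> \<bar>A $ t \<bullet> v\<bar>" using t by linarith
  also have "\<dots> \<le> norm (A $ t) * norm v" by (rule Cauchy_Schwarz_ineq2)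
  also have "\<dots> \<le> norm (A $ t) * r" using v(1) by (intro mult_left_mono) auto
  finally show "u \<in> (\<Union>t\<in>{t. A $ t \<noteq> 0}. {u. \<bar>A $ t \<bullet> u - c $ t\<bar> \<le> norm (A $ t) * r})"
    using \<open>A $ t \<noteq> 0\<close> by blast
qed

lemma prob_walk_slab_le:
  fixes P :: "(real^'d::finite) pmf"
  assumes fin: "finite (set_pmf P)" and iso: "isotropic (measure_pmf P)" and a: "a \<noteq> 0"
  shows "\<exists>C\<ge>0. \<forall>k c r. r \<ge> 0 \<longrightarrow>
    measure_pmf.prob (walk_pmf P k) {u. \<bar>a \<bullet> u - c\<bar> \<le> norm a * r} \<le> C * (r + 1) / sqrt (real k + 1)"
proof -
  let ?Q = "map_pmf ((\<bullet>) a) P"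
  have "measure_pmf.variance ?Q (\<lambda>x. x) = (norm a)\<^sup>2"
    by (simp add: isotropicD[OF iso])
  hence "finite (set_pmf ?Q)" "measure_pmf.variance ?Q (\<lambda>x. x) > 0"
    using a fin by simp_all
  then obtain C where C: "C \<ge> 0" "\<And>k c r. r \<ge> 0 \<Longrightarrow>
      measure_pmf.prob (walk_pmf ?Q k) {s. \<bar>s - c\<bar> \<le> r} \<le> C * (r + 1) / sqrt (real k + 1)"
    using prob_walk_interval_le_uniform by meson
  have "measure_pmf.prob (walk_pmf P k) {u. \<bar>a \<bullet> u - c\<bar> \<le> norm a * r} \<le>
      C * (norm a + 1) * (r + 1) / sqrt (real k + 1)" if "r \<ge> 0" for k c r
  proof -
    have "walk_pmf ?Q k = map_pmf ((\<bullet>) a) (walk_pmf P k)"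
      by (rule map_walk_pmf[symmetric]) (intro bounded_linear.linear bounded_linear_inner_right)
    hence "measure_pmf.prob (walk_pmf P k) {u. \<bar>a \<bullet> u - c\<bar> \<le> norm a * r} =
        measure_pmf.prob (walk_pmf ?Q k) {s. \<bar>s - c\<bar> \<le> norm a * r}"
      by (simp add: vimage_def)
    also have "\<dots> \<le> C * (norm a * r + 1) / sqrt (real k + 1)"
      using that by (intro C) simp
    also have "\<dots> \<le> C * ((norm a + 1) * (r + 1)) / sqrt (real k + 1)"
      using that C(1) by (intro divide_right_mono mult_left_mono) (auto simp: algebra_simps)
    finally show ?thesis by (simp add: mult.assoc)
  qed
  thus ?thesis using C(1) by (intro exI[of _ "C * (norm a + 1)"]) auto
qed

lemma prob_walk_boundary_orthant_le:
  fixes P :: "(real^'d::finite) pmf" and A :: "real^'d^'e::finite"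
  assumes fin: "finite (set_pmf P)" and iso: "isotropic (measure_pmf P)"
  shows "\<exists>C. \<forall>k c r. r \<ge> 0 \<longrightarrow>
    measure_pmf.prob (walk_pmf P k) (boundary_nbhd {u. c \<le> A *v u} r) \<le>
      C * (r + 1) / sqrt (real k + 1)"
proof -
  obtain C where C: "\<And>a k c r. a \<noteq> 0 \<Longrightarrow> r \<ge> 0 \<Longrightarrow>
      measure_pmf.prob (walk_pmf P k) {u. \<bar>a \<bullet> u - c\<bar> \<le> norm a * r} \<le>
        C a * (r + 1) / sqrt (real k + 1)"
    using prob_walk_slab_le[OF fin iso] by metis
  have "measure_pmf.prob (walk_pmf P k) (boundary_nbhd {u. c \<le> A *v u} r) \<le>
      (\<Sum>t | A $ t \<noteq> 0. C (A $ t)) * (r + 1) / sqrt (real k + 1)" if "r \<ge> 0" for k c r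
  proof -
    have "measure_pmf.prob (walk_pmf P k) (boundary_nbhd {u. c \<le> A *v u} r) \<le>
        measure_pmf.prob (walk_pmf P k)
          (\<Union>t\<in>{t. A $ t \<noteq> 0}. {u. \<bar>A $ t \<bullet> u - c $ t\<bar> \<le> norm (A $ t) * r})"
      by (intro measure_pmf.finite_measure_mono boundary_nbhd_orthant_subset) simp
    also have "\<dots> \<le> (\<Sum>t | A $ t \<noteq> 0.
        measure_pmf.prob (walk_pmf P k) {u. \<bar>A $ t \<bullet> u - c $ t\<bar> \<le> norm (A $ t) * r})"
      by (intro measure_pmf.finite_measure_subadditive_finite) auto
    also have "\<dots> \<le> (\<Sum>t | A $ t \<noteq> 0. C (A $ t) * (r + 1) / sqrt (real k + 1))"
      using that by (intro sum_mono C) auto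
    finally show ?thesis by (simp add: sum_distrib_right sum_divide_distrib)
  qed
  thus ?thesis by blast
qed

theorem berry_esseen_orthant:
  fixes P :: "(real^'d::finite) pmf" and A :: "real^'d^'e::finite"
  assumes fin: "finite (set_pmf P)" and iso: "isotropic (measure_pmf P)"
  shows "\<exists>C. \<forall>n>0. \<forall>c.
    \<bar>measure_pmf.prob (walk_pmf P n) {u. sqrt (real n) *\<^sub>R c \<le> A *v u}
      - measure gauss_measure {w. c \<le> A *v w}\<bar> \<le> C * (1 + ln (real n)) / sqrt (real n)"
proof -
  obtain D where D: "\<And>k c r. r \<ge> 0 \<Longrightarrow>
      measure_pmf.prob (walk_pmf P k) (boundary_nbhd {u. c \<le> A *v u} r) \<le>
        D * (r + 1) / sqrt (real k + 1)"
    using prob_walk_boundary_orthant_le[OF fin iso, of A] by blast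
  obtain M where M: "\<And>x. x \<in> set_pmf P \<Longrightarrow> norm x \<le> M"
    using finite_imp_bounded[OF fin] by (auto simp: bounded_iff)
  have "{w. c \<le> A *v w} = {w. sqrt (real n) *\<^sub>R w \<in> {u. sqrt (real n) *\<^sub>R c \<le> A *v u}}"
    if "n > 0" for n c
    using that by (auto simp: less_eq_vec_def matrix_vector_mult_scaleR)
  moreover have "{u. c \<le> A *v u} \<in> sets borel" for c
    by (intro borel_closed closed_upper_orthant_preimage)
  ultimately show ?thesis
    using berry_esseen_thin_boundary[OF fin iso M _ _ D] by metis
qed

section \<open>Lifting to isotropic steps\<close>

lemma expectation_pair_pmf_finite:
  fixes h :: "'a \<times> 'b \<Rightarrow> 'c::{banach, second_countable_topology}"
  assumes "finite (set_pmf P)" "finite (set_pmf Q)"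
  shows "measure_pmf.expectation (pair_pmf P Q) h =
    measure_pmf.expectation P (\<lambda>x. measure_pmf.expectation Q (\<lambda>y. h (x, y)))"
  using assms by (simp add: pair_pmf_def expectation_bind_pmf_finite)

lemma isotropic_pmf_exists:
  "\<exists>Z :: 'v::euclidean_space pmf. finite (set_pmf Z) \<and> isotropic (measure_pmf Z)"
proof (intro exI conjI)
  define d where "d = real DIM('v)"
  define Z :: "'v pmf" where
    "Z = map_pmf (\<lambda>(b, s). (s * sqrt d) *\<^sub>R b) (pair_pmf (pmf_of_set Basis) (pmf_of_set {-1, 1}))"
  have d: "d > 0" by (simp add: d_def)
  show "finite (set_pmf Z)" by (simp add: Z_def)
  have expectation_Z: "measure_pmf.expectation Z h =
      (\<Sum>b\<in>Basis. h (sqrt d *\<^sub>R b) + h (- sqrt d *\<^sub>R b)) / (2 * d)"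
    for h :: "'v \<Rightarrow> real"
    by (simp add: Z_def d_def expectation_pair_pmf_finite integral_pmf_of_set sum_divide_distrib
        add.commute mult.commute[of 2])
  show "isotropic (measure_pmf Z)"
    unfolding isotropic_def
  proof (intro conjI allI)
    fix c :: 'v
    show "measure_pmf.expectation Z (\<lambda>x. c \<bullet> x) = 0"
      by (simp add: expectation_Z)
    have "measure_pmf.expectation Z (\<lambda>x. (c \<bullet> x)\<^sup>2) = (\<Sum>b\<in>Basis. (c \<bullet> b)\<^sup>2)"
      using d by (simp add: expectation_Z power_mult_distrib sum_distrib_left[symmetric])
    thus "measure_pmf.expectation Z (\<lambda>x. (c \<bullet> x)\<^sup>2) = (norm c)\<^sup>2"
      by (simp add: power2_norm_eq_sum_Basis)
  qed
qed

lemma orthogonal_projection_exists: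
  fixes R :: "'v::euclidean_space set"
  assumes "subspace R"
  shows "\<exists>proj. (\<forall>u. proj u \<in> R) \<and> (\<forall>u. \<forall>w\<in>R. (u - proj u) \<bullet> w = 0)"
proof -
  have "span R = R" using assms by simp
  have "\<exists>y\<in>R. \<forall>w\<in>R. (u - y) \<bullet> w = 0" for u
  proof -
    obtain y z where "y \<in> R" "\<And>w. w \<in> R \<Longrightarrow> orthogonal z w" "u = y + z"
      using orthogonal_subspace_decomp_exists[of R u] unfolding \<open>span R = R\<close> by blast
    thus ?thesis by (intro bexI[of _ y]) (auto simp: orthogonal_def)
  qed
  thus ?thesis by metis
qed

lemma set_pmf_subset_range_covariance_factor:
  fixes P :: "(real^'e::finite) pmf" and A :: "real^'d::finite^'e"
  assumes fin: "finite (set_pmf P)"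
    and cov: "\<And>c. measure_pmf.expectation P (\<lambda>y. (c \<bullet> y)\<^sup>2) = (norm (c v* A))\<^sup>2"
  shows "set_pmf P \<subseteq> range ((*v) A)"
proof
  fix y assume y: "y \<in> set_pmf P"
  have "subspace (range ((*v) A))"
    by (intro linear_subspace_image matrix_vector_mul_linear) simp
  then obtain proj where proj: "proj y \<in> range ((*v) A)"
    "\<And>w. w \<in> range ((*v) A) \<Longrightarrow> (y - proj y) \<bullet> w = 0"
    using orthogonal_projection_exists by metis
  define z where "z = y - proj y"
  have "(z v* A) \<bullet> w = 0" for w
    using proj(2)[of "A *v w"] by (simp add: z_def dot_lmul_matrix)
  hence "z v* A = 0" by (metis inner_eq_zero_iff)
  hence "measure_pmf.expectation P (\<lambda>y. (z \<bullet> y)\<^sup>2) = 0"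
    by (simp add: cov)
  hence "AE y in measure_pmf P. (z \<bullet> y)\<^sup>2 = 0"
    by (subst (asm) integral_nonneg_eq_0_iff_AE) (auto simp: integrable_measure_pmf_finite fin)
  hence "z \<bullet> y = 0" using y by (simp add: AE_measure_pmf_iff)
  moreover have "z \<bullet> proj y = 0" using proj(2)[OF proj(1)] by (simp add: z_def)
  moreover have "z \<bullet> z = z \<bullet> y - z \<bullet> proj y" by (simp add: z_def inner_diff_right)
  ultimately have "z = 0" by simp
  thus "y \<in> range ((*v) A)" using proj(1) by (simp add: z_def)
qed

lemma row_space_projection:
  fixes A :: "real^'d::finite^'e::finite"
  obtains proj row where "\<And>c. proj c = row c v* A" "\<And>c u. c \<bullet> proj u = proj c \<bullet> u"
    "\<And>u. A *v proj u = A *v u" "\<And>c. (norm (proj c))\<^sup>2 + (norm (c - proj c))\<^sup>2 = (norm c)\<^sup>2"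
proof -
  define R where "R = range (\<lambda>c. c v* A)"
  have "subspace R"
    unfolding R_def
    using linear_subspace_image[OF matrix_vector_mul_linear[of "transpose A"], of UNIV] by simp
  then obtain proj where proj: "\<And>u. proj u \<in> R" "\<And>u w. w \<in> R \<Longrightarrow> (u - proj u) \<bullet> w = 0"
    using orthogonal_projection_exists by metis
  obtain row where row: "\<And>c. proj c = row c v* A"
    using proj(1) unfolding R_def image_iff by metis
  have self_adjoint: "c \<bullet> proj u = proj c \<bullet> u" for c u
    using proj(2)[OF proj(1)[of u], of c] proj(2)[OF proj(1)[of c], of u]
    by (simp add: inner_diff_left inner_diff_right inner_commute)
  have "A *v proj u = A *v u" for u
  proof -
    have "c \<bullet> (A *v (u - proj u)) = 0" for c
      using proj(2)[of "c v* A" u] by (simp add: R_def inner_commute flip: dot_lmul_matrix)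
    hence "A *v (u - proj u) = 0" by (metis inner_eq_zero_iff)
    thus ?thesis by (simp add: matrix_vector_mult_diff_distrib)
  qed
  moreover have "(norm (proj c))\<^sup>2 + (norm (c - proj c))\<^sup>2 = (norm c)\<^sup>2" for c
    using proj(2)[OF proj(1)[of c], of c]
    by (simp add: power2_norm_eq_inner inner_diff_left inner_diff_right inner_commute)
  ultimately show ?thesis using that row self_adjoint by blast
qed

text \<open>If \<open>A\<close> is singular, preimages of the steps under \<open>A\<close> only span its row space; an independent
  isotropic vector supplies the missing variance on the kernel of \<open>A\<close>.\<close>

lemma isotropic_lift_exists:
  fixes P :: "(real^'e::finite) pmf" and A :: "real^'d::finite^'e"
  assumes fin: "finite (set_pmf P)"
    and mean: "\<And>c. measure_pmf.expectation P (\<lambda>y. c \<bullet> y) = 0"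
    and cov: "\<And>c. measure_pmf.expectation P (\<lambda>y. (c \<bullet> y)\<^sup>2) = (norm (c v* A))\<^sup>2"
  shows "\<exists>Q. finite (set_pmf Q) \<and> isotropic (measure_pmf Q) \<and> map_pmf ((*v) A) Q = P"
proof -
  obtain proj row where row: "\<And>c. proj c = row c v* A"
    and self_adjoint: "\<And>c u. c \<bullet> proj u = proj c \<bullet> u"
    and A_proj: "\<And>u. A *v proj u = A *v u"
    and pythagoras: "\<And>c. (norm (proj c))\<^sup>2 + (norm (c - proj c))\<^sup>2 = (norm c)\<^sup>2"
    using row_space_projection[of A] by metis
  have "\<forall>y\<in>set_pmf P. \<exists>v. A *v v = y"
    using set_pmf_subset_range_covariance_factor[OF fin cov] by (auto simp: image_iff)
  then obtain u where u: "\<And>y. y \<in> set_pmf P \<Longrightarrow> A *v u y = y"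
    by metis
  obtain Z :: "(real^'d) pmf" where Z: "finite (set_pmf Z)" "isotropic (measure_pmf Z)"
    using isotropic_pmf_exists by blast
  note [simp] = integrable_measure_pmf_finite[OF fin] integrable_measure_pmf_finite[OF Z(1)]
  define \<xi> where "\<xi> = (\<lambda>(y, \<zeta>). proj (u y) + (\<zeta> - proj \<zeta>))"
  define Q where "Q = map_pmf \<xi> (pair_pmf P Z)"
  have "isotropic (measure_pmf Q)"
    unfolding isotropic_def
  proof (intro conjI allI)
    fix c :: "real^'d"
    have "c \<bullet> \<xi> (y, \<zeta>) = row c \<bullet> y + (c - proj c) \<bullet> \<zeta>" if "y \<in> set_pmf P" for y \<zeta>
      using u[OF that]
      by (simp add: \<xi>_def inner_add_right inner_diff_right inner_diff_left self_adjoint row[of c]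
          dot_lmul_matrix)
    hence expectation_Q: "measure_pmf.expectation Q (\<lambda>x. h (c \<bullet> x)) =
        measure_pmf.expectation P
          (\<lambda>y. measure_pmf.expectation Z (\<lambda>\<zeta>. h (row c \<bullet> y + (c - proj c) \<bullet> \<zeta>)))"
      for h :: "real \<Rightarrow> real"
      unfolding Q_def integral_map_pmf expectation_pair_pmf_finite[OF fin Z(1)]
      by (intro integral_cong_AE) (auto simp: AE_measure_pmf_iff)
    show "measure_pmf.expectation Q (\<lambda>x. c \<bullet> x) = 0"
      using expectation_Q[of "\<lambda>s. s"] by (simp add: mean isotropicD[OF Z(2)])
    have "measure_pmf.expectation Q (\<lambda>x. (c \<bullet> x)\<^sup>2) = (norm (proj c))\<^sup>2 + (norm (c - proj c))\<^sup>2"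
      using expectation_Q[of "\<lambda>s. s\<^sup>2"]
      by (simp add: power2_sum mean cov isotropicD[OF Z(2)] row[of c])
    also have "\<dots> = (norm c)\<^sup>2" by (rule pythagoras)
    finally show "measure_pmf.expectation Q (\<lambda>x. (c \<bullet> x)\<^sup>2) = (norm c)\<^sup>2" .
  qed
  moreover have "map_pmf ((*v) A) Q = P"
  proof -
    have "map_pmf ((*v) A) Q = map_pmf fst (pair_pmf P Z)"
      unfolding Q_def pmf.map_comp
      by (intro map_pmf_cong refl)
         (auto simp: \<xi>_def A_proj u matrix_vector_right_distrib matrix_vector_mult_diff_distrib)
    thus ?thesis by (simp add: map_fst_pair_pmf)
  qed
  moreover have "finite (set_pmf Q)"
    using fin Z(1) by (simp add: Q_def)
  ultimately show ?thesis by blast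
qed

theorem berry_esseen_upper_orthant:
  fixes P :: "(real^'e::finite) pmf" and A :: "real^'d::finite^'e"
  assumes "finite (set_pmf P)"
    and "\<And>c. measure_pmf.expectation P (\<lambda>y. c \<bullet> y) = 0"
    and "\<And>c. measure_pmf.expectation P (\<lambda>y. (c \<bullet> y)\<^sup>2) = (norm (c v* A))\<^sup>2"
  shows "\<exists>C. \<forall>n>0. \<forall>z.
    \<bar>measure_pmf.prob (walk_pmf P n) {u. sqrt (real n) *\<^sub>R z \<le> u}
      - measure gauss_measure {w. z \<le> A *v w}\<bar> \<le> C * (1 + ln (real n)) / sqrt (real n)"
proof -
  obtain Q where Q: "finite (set_pmf Q)" "isotropic (measure_pmf Q)" "map_pmf ((*v) A) Q = P"
    using isotropic_lift_exists[OF assms] by blast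
  have "walk_pmf P n = map_pmf ((*v) A) (walk_pmf Q n)" for n
    by (simp add: Q(3) map_walk_pmf matrix_vector_mul_linear)
  thus ?thesis
    using berry_esseen_orthant[OF Q(1,2), of A] by (simp add: vimage_def)
qed

lemma gram_matrix_factorization:
  fixes b :: "'a::finite \<Rightarrow> real^'d::finite"
  shows "\<exists>A :: real^'d^'d. A ** transpose A = (\<Sum>x\<in>UNIV. outer (b x))"
proof -
  define \<beta> :: "'d \<Rightarrow> real^'a" where "\<beta> i = (\<chi> x. b x $ i)" for i
  define S where "S = span (range \<beta>)"
  have "dim S \<le> card (range \<beta>)" unfolding S_def dim_span by (rule dim_le_card') simp
  also have "\<dots> \<le> CARD('d)" by (rule card_image_le) simp
  finally have "dim S \<le> dim (UNIV :: (real^'d) set)" by simp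
  then obtain f :: "real^'a \<Rightarrow> real^'d" where f: "linear f" "\<And>x. x \<in> S \<Longrightarrow> norm (f x) = norm x"
    using isometry_subset_subspace[of S "UNIV :: (real^'d) set"] unfolding S_def by auto
  have \<beta>: "\<beta> i \<in> S" for i unfolding S_def by (intro span_base) auto
  have isometry: "f (\<beta> i) \<bullet> f (\<beta> j) = \<beta> i \<bullet> \<beta> j" for i j
  proof -
    have "\<beta> i + \<beta> j \<in> S" using \<beta> unfolding S_def by (intro span_add) auto
    hence "norm (f (\<beta> i) + f (\<beta> j)) = norm (\<beta> i + \<beta> j)"
      using f by (metis linear_add)
    thus ?thesis by (simp add: dot_norm f(2) \<beta>)
  qed
  define A where "A = (\<chi> i. f (\<beta> i))"
  have "(A ** transpose A) $ i $ j = (\<Sum>x\<in>UNIV. outer (b x)) $ i $ j" for i j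
  proof -
    have "(A ** transpose A) $ i $ j = f (\<beta> i) \<bullet> f (\<beta> j)"
      by (simp add: A_def matrix_matrix_mult_def transpose_def inner_vec_def)
    also have "\<dots> = \<beta> i \<bullet> \<beta> j"
      by (rule isometry)
    also have "\<dots> = (\<Sum>x\<in>UNIV. outer (b x)) $ i $ j"
      by (simp add: \<beta>_def inner_vec_def outer_def)
    finally show ?thesis .
  qed
  hence "A ** transpose A = (\<Sum>x\<in>UNIV. outer (b x))"
    by (simp add: vec_eq_iff)
  thus ?thesis by blast
qed

lemma covariance_factorization:
  fixes Y :: "'a::finite \<Rightarrow> real^'d::finite"
  assumes "\<And>x. p x \<ge> 0"
  shows "\<exists>A :: real^'d^'d. A ** transpose A = (\<Sum>x\<in>UNIV. p x *\<^sub>R outer (Y x))"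
proof -
  have "outer (sqrt (p x) *\<^sub>R Y x) = p x *\<^sub>R outer (Y x)" for x
    using assms[of x] by (simp add: outer_def vec_eq_iff)
  thus ?thesis using gram_matrix_factorization[of "\<lambda>x. sqrt (p x) *\<^sub>R Y x"] by simp
qed

lemma inner_outer_mult: "c \<bullet> (outer y *v c) = (c \<bullet> y)\<^sup>2"
proof -
  have "outer y *v c = (c \<bullet> y) *\<^sub>R y"
    by (simp add: vec_eq_iff outer_def matrix_vector_mult_def inner_vec_def sum_distrib_left
        mult_ac)
  thus ?thesis by (simp add: power2_eq_square)
qed

lemma sum_matrix_vector_mult: "(\<Sum>x\<in>S. M x) *v v = (\<Sum>x\<in>S. (M x :: real^'n::finite^'m::finite) *v v)"
  by (induction S rule: infinite_finite_induct) (simp_all add: matrix_vector_mult_add_rdistrib)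

lemma covariance_quadratic_form:
  fixes Y :: "'a::finite \<Rightarrow> real^'e::finite" and A :: "real^'d::finite^'e"
  assumes "A ** transpose A = (\<Sum>x\<in>UNIV. p x *\<^sub>R outer (Y x))"
  shows "(\<Sum>x\<in>UNIV. p x * (c \<bullet> Y x)\<^sup>2) = (norm (c v* A))\<^sup>2"
proof -
  have "(\<Sum>x\<in>UNIV. p x * (c \<bullet> Y x)\<^sup>2) = c \<bullet> ((\<Sum>x\<in>UNIV. p x *\<^sub>R outer (Y x)) *v c)"
    by (simp add: sum_matrix_vector_mult inner_sum_right inner_outer_mult
        flip: scaleR_matrix_vector_assoc)
  also have "\<dots> = c \<bullet> (A *v (c v* A))"
    by (simp flip: assms matrix_vector_mul_assoc)
  also have "\<dots> = (norm (c v* A))\<^sup>2"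
    by (simp add: power2_norm_eq_inner dot_lmul_matrix)
  finally show ?thesis .
qed

section \<open>Concentration of types\<close>

lemma expectation_exp_le_hoeffding:
  fixes f :: "'a \<Rightarrow> real"
  assumes fin: "finite (set_pmf P)" and mean: "measure_pmf.expectation P f = 0"
    and bounds: "\<And>x. x \<in> set_pmf P \<Longrightarrow> f x \<in> {a..b}"
  shows "measure_pmf.expectation P (\<lambda>x. exp (f x)) \<le> exp ((b - a)\<^sup>2 / 8)"
proof -
  interpret interval_bounded_random_variable "measure_pmf P" f a b
    using bounds by unfold_locales (simp_all add: AE_measure_pmf_iff)
  have "(\<integral>\<^sup>+x. ennreal (exp (1 * f x)) \<partial>measure_pmf P) \<le> ennreal (exp (1\<^sup>2 * (b - a)\<^sup>2 / 8))"
    by (rule Hoeffdings_lemma_nn_integral_0) (use mean in auto)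
  thus ?thesis
    by (simp add: nn_integral_eq_integral integrable_measure_pmf_finite[OF fin])
qed

text \<open>The square is linearised by \<open>exp (\<bar>y\<bar>\<^sup>2 / 2) = E exp (w \<bullet> y)\<close> for a standard Gaussian \<open>w\<close>.\<close>

lemma expectation_exp_norm_walk_le:
  fixes P :: "(real^'d::finite) pmf"
  assumes fin: "finite (set_pmf P)"
    and subgauss: "\<And>c. measure_pmf.expectation P (\<lambda>x. exp (c \<bullet> x)) \<le> exp ((norm c)\<^sup>2 / 2)"
    and a: "a \<ge> 0" "real n * a < 1"
  shows "measure_pmf.expectation (walk_pmf P n) (\<lambda>u. exp (a * (norm u)\<^sup>2 / 2)) \<le>
    (\<integral>w. exp (real n * a / 2 * (norm w)\<^sup>2) \<partial>(gauss_measure :: (real^'d) measure))"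
proof -
  define y where "y u = sqrt a *\<^sub>R u" for u :: "real^'d"
  note swap = expectation_pmf_integral_swap[OF finite_set_pmf_walk[OF fin],
    where f = "\<lambda>u w. exp (w \<bullet> y u)", OF gauss_integrable_exp_inner]
  have "exp (a * (norm u)\<^sup>2 / 2) = (\<integral>w. exp (w \<bullet> y u) \<partial>gauss_measure)" for u
    using a by (simp only: gauss_integral_exp_inner) (simp add: y_def power_mult_distrib)
  hence "measure_pmf.expectation (walk_pmf P n) (\<lambda>u. exp (a * (norm u)\<^sup>2 / 2)) =
      (\<integral>w. measure_pmf.expectation (walk_pmf P n) (\<lambda>u. exp (w \<bullet> y u)) \<partial>gauss_measure)"
    by (simp add: swap(2))
  also have "\<dots> \<le> (\<integral>w. exp (real n * a / 2 * (norm w)\<^sup>2) \<partial>(gauss_measure :: (real^'d) measure))"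
  proof (intro integral_mono swap(1) gauss_integrable_exp_norm)
    fix w :: "real^'d"
    have "measure_pmf.expectation (walk_pmf P n) (\<lambda>u. exp (w \<bullet> y u)) =
        measure_pmf.expectation P (\<lambda>x. exp (w \<bullet> y x)) ^ n"
      by (rule expectation_walk_multiplicative[OF fin])
         (simp_all add: y_def inner_add_right distrib_left exp_add)
    also have "\<dots> \<le> exp ((norm (sqrt a *\<^sub>R w))\<^sup>2 / 2) ^ n"
      using subgauss[of "sqrt a *\<^sub>R w"]
      by (intro power_mono Bochner_Integration.integral_nonneg) (simp_all add: y_def)
    also have "\<dots> = exp (real n * a / 2 * (norm w)\<^sup>2)"
      using a by (simp add: power_mult_distrib mult_ac flip: exp_of_nat_mult)
    finally show "measure_pmf.expectation (walk_pmf P n) (\<lambda>u. exp (w \<bullet> y u)) \<le>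
        exp (real n * a / 2 * (norm w)\<^sup>2)" .
  qed (use a in simp)
  finally show ?thesis .
qed

lemma prob_norm_walk_gt_le:
  fixes P :: "(real^'d::finite) pmf"
  assumes fin: "finite (set_pmf P)"
    and subgauss: "\<And>c. measure_pmf.expectation P (\<lambda>x. exp (c \<bullet> x)) \<le> exp ((norm c)\<^sup>2 / 2)"
    and n: "n > 0"
  shows "measure_pmf.prob (walk_pmf P n) {u. (norm u)\<^sup>2 > 4 * real n * s} \<le>
    (\<integral>w. exp (1 / 4 * (norm w)\<^sup>2) \<partial>(gauss_measure :: (real^'d) measure)) * exp (- s)"
proof -
  define a where "a = 1 / (2 * real n)"
  have a: "a \<ge> 0" "real n * a = 1 / 2" using n by (simp_all add: a_def)
  have "measure_pmf.prob (walk_pmf P n) {u. (norm u)\<^sup>2 > 4 * real n * s} =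
      measure_pmf.expectation (walk_pmf P n) (indicator {u. (norm u)\<^sup>2 > 4 * real n * s})"
    by simp
  also have "\<dots> \<le> measure_pmf.expectation (walk_pmf P n) (\<lambda>u. exp (a * (norm u)\<^sup>2 / 2) * exp (- s))"
  proof (intro expectation_pmf_mono finite_set_pmf_walk fin)
    fix u
    show "indicator {u. (norm u)\<^sup>2 > 4 * real n * s} u \<le> exp (a * (norm u)\<^sup>2 / 2) * exp (- s)"
      using n by (auto simp: indicator_def a_def field_simps simp flip: exp_add)
  qed
  also have "\<dots> = measure_pmf.expectation (walk_pmf P n) (\<lambda>u. exp (a * (norm u)\<^sup>2 / 2)) * exp (- s)"
    by simp
  also have "\<dots> \<le> (\<integral>w. exp (1 / 4 * (norm w)\<^sup>2) \<partial>(gauss_measure :: (real^'d) measure)) * exp (- s)"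
    using expectation_exp_norm_walk_le[OF fin subgauss a(1), of n] a by (intro mult_right_mono) auto
  finally show ?thesis .
qed

definition simplex_pmf :: "real^'a::finite \<Rightarrow> 'a pmf" where
  "simplex_pmf p = embed_pmf (($) p)"

lemma pmf_simplex_pmf:
  assumes "p \<in> prob_simplex"
  shows "pmf (simplex_pmf p) x = p $ x"
  using assms unfolding simplex_pmf_def prob_simplex_def
  by (intro pmf_embed_pmf)
     (auto simp: nn_integral_count_space_finite sum_ennreal simp flip: ennreal_1)

lemma expectation_simplex_pmf:
  fixes f :: "'a::finite \<Rightarrow> real"
  assumes "p \<in> prob_simplex"
  shows "measure_pmf.expectation (simplex_pmf p) f = (\<Sum>x\<in>UNIV. p $ x * f x)"
  by (simp add: integral_measure_pmf[of UNIV] pmf_simplex_pmf[OF assms])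

lemma replicate_map_pmf: "replicate_pmf n (map_pmf f P) = map_pmf (map f) (replicate_pmf n P)"
  by (induction n) (simp_all add: map_bind_pmf bind_map_pmf)

lemma pmf_replicate_pmf: "pmf (replicate_pmf (length xs) P) xs = (\<Prod>i<length xs. pmf P (xs ! i))"
proof (induction xs)
  case (Cons x xs)
  have "replicate_pmf (length (x # xs)) P =
      map_pmf (\<lambda>(y, ys). y # ys) (pair_pmf P (replicate_pmf (length xs) P))"
    by (simp add: pair_pmf_def map_bind_pmf)
  moreover have "inj (\<lambda>(y :: 'a, ys). y # ys)" by (auto simp: inj_def)
  ultimately have "pmf (replicate_pmf (length (x # xs)) P) (x # xs) =
      pmf P x * pmf (replicate_pmf (length xs) P) xs"
    using pmf_map_inj'[of "\<lambda>(y, ys). y # ys" "pair_pmf P (replicate_pmf (length xs) P)" "(x, xs)"]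
    by (simp add: pmf_pair)
  thus ?case
    by (simp add: Cons.IH prod.lessThan_Suc_shift del: replicate_pmf.simps prod.lessThan_Suc)
qed simp

lemma iid_prob_eq_prob_replicate_pmf:
  assumes "p \<in> prob_simplex"
  shows "iid_prob p n E = measure_pmf.prob (replicate_pmf n (simplex_pmf p)) {xs. E xs}"
proof -
  let ?R = "replicate_pmf n (simplex_pmf p)"
  have "{xs. E xs} \<inter> set_pmf ?R = {xs. length xs = n \<and> E xs} \<inter> set_pmf ?R"
    by (auto simp: set_replicate_pmf)
  hence "measure_pmf.prob ?R {xs. E xs} = measure_pmf.prob ?R {xs. length xs = n \<and> E xs}"
    by (metis measure_Int_set_pmf)
  also have "\<dots> = (\<Sum>xs | length xs = n \<and> E xs. pmf ?R xs)"
    using finite_lists_length_eq[of "UNIV :: 'a set" n]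
    by (intro measure_measure_pmf_finite) (auto intro: finite_subset)
  also have "\<dots> = iid_prob p n E"
    unfolding iid_prob_def
    by (intro sum.cong refl) (auto simp: pmf_replicate_pmf pmf_simplex_pmf[OF assms])
  finally show ?thesis ..
qed

definition centred_letter_pmf :: "real^'a::finite \<Rightarrow> (real^'a) pmf" where
  "centred_letter_pmf p = map_pmf (\<lambda>x. axis x 1 - p) (simplex_pmf p)"

lemma finite_set_centred_letter_pmf: "finite (set_pmf (centred_letter_pmf p))"
  by (simp add: centred_letter_pmf_def)

lemma sum_list_map_axis_minus:
  "sum_list (map (\<lambda>x. axis x 1 - p) xs) = real (length xs) *\<^sub>R (type_of xs - p)"
proof -
  have "sum_list (map (\<lambda>x. axis x 1 - p) xs) $ a =
      real (count_list xs a) - real (length xs) * p $ a" for a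
    by (induction xs) (auto simp: axis_def algebra_simps)
  thus ?thesis by (cases "xs = []") (auto simp: vec_eq_iff type_of_def algebra_simps)
qed

lemma iid_prob_type_eq_prob_walk:
  assumes "p \<in> prob_simplex" "n > 0"
  shows "iid_prob p n (\<lambda>xs. F (type_of xs)) =
    measure_pmf.prob (walk_pmf (centred_letter_pmf p) n) {S. F (p + S /\<^sub>R real n)}"
proof -
  let ?R = "replicate_pmf n (simplex_pmf p)"
  have "walk_pmf (centred_letter_pmf p) n = map_pmf (\<lambda>xs. real n *\<^sub>R (type_of xs - p)) ?R"
    unfolding walk_pmf_def centred_letter_pmf_def replicate_map_pmf pmf.map_comp
    by (intro map_pmf_cong refl) (simp add: set_replicate_pmf sum_list_map_axis_minus)
  thus ?thesis
    using assms by (simp add: iid_prob_eq_prob_replicate_pmf vimage_def)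
qed

lemma expectation_centred_letter_pmf:
  fixes f :: "real^'a::finite \<Rightarrow> real"
  assumes "p \<in> prob_simplex"
  shows "measure_pmf.expectation (centred_letter_pmf p) f = (\<Sum>x\<in>UNIV. p $ x * f (axis x 1 - p))"
  by (simp add: centred_letter_pmf_def expectation_simplex_pmf[OF assms])

lemma expectation_inner_centred_letter_pmf:
  assumes "p \<in> prob_simplex"
  shows "measure_pmf.expectation (centred_letter_pmf p) (\<lambda>x. c \<bullet> x) = 0"
proof -
  have "(\<Sum>x\<in>UNIV. p $ x * (c $ x - c \<bullet> p)) = c \<bullet> p - (\<Sum>x\<in>UNIV. p $ x) * (c \<bullet> p)"
    by (simp add: right_diff_distrib sum_subtractf sum_distrib_right inner_vec_def mult.commute)
  thus ?thesis
    using assms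
    by (simp add: expectation_centred_letter_pmf inner_diff_right inner_axis prob_simplex_def)
qed

lemma centred_letter_pmf_subgaussian:
  assumes "p \<in> prob_simplex"
  shows "measure_pmf.expectation (centred_letter_pmf p) (\<lambda>x. exp (c \<bullet> x)) \<le> exp ((norm c)\<^sup>2 / 2)"
proof -
  have "c \<bullet> x \<in> {- norm c - c \<bullet> p..norm c - c \<bullet> p}" if "x \<in> set_pmf (centred_letter_pmf p)" for x
    using that component_le_norm_cart[of c]
    by (auto simp: centred_letter_pmf_def inner_diff_right inner_axis abs_le_iff minus_le_iff)
  from expectation_exp_le_hoeffding[OF finite_set_centred_letter_pmf
      expectation_inner_centred_letter_pmf[OF assms] this]
  show ?thesis by (simp add: power2_eq_square)
qed

lemma type_concentration:
  fixes p :: "real^'a::finite"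
  assumes p: "p \<in> prob_simplex"
  shows "\<exists>K\<ge>0. \<forall>n>0. measure_pmf.prob (walk_pmf (centred_letter_pmf p) n)
    {S. (norm S)\<^sup>2 > 2 * real n * log 2 (real n)} \<le> K / sqrt (real n)"
proof (intro exI conjI allI impI)
  define K where "K = (\<integral>w. exp (1 / 4 * (norm w)\<^sup>2) \<partial>(gauss_measure :: (real^'a) measure))"
  show "K \<ge> 0" by (simp add: K_def Bochner_Integration.integral_nonneg)
  fix n :: nat assume n: "n > 0"
  have "measure_pmf.prob (walk_pmf (centred_letter_pmf p) n)
        {S. (norm S)\<^sup>2 > 2 * real n * log 2 (real n)} \<le>
      K * exp (- (log 2 (real n) / 2))"
    using prob_norm_walk_gt_le[OF finite_set_centred_letter_pmf
        centred_letter_pmf_subgaussian[OF p] n, of "log 2 (real n) / 2"]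
    by (simp add: K_def mult.assoc)
  also have "exp (- (log 2 (real n) / 2)) \<le> exp (- (ln (real n) / 2))"
    using ln_2_less_1 n by (simp add: log_def le_divide_eq mult_left_le)
  also have "exp (- (ln (real n) / 2)) = 1 / sqrt (real n)"
    using n by (simp add: exp_minus inverse_eq_divide flip: ln_sqrt)
  finally show "measure_pmf.prob (walk_pmf (centred_letter_pmf p) n)
      {S. (norm S)\<^sup>2 > 2 * real n * log 2 (real n)} \<le> K / sqrt (real n)"
    using \<open>K \<ge> 0\<close> by (simp add: mult_left_mono)
qed

section \<open>Second-order Taylor bounds\<close>

lemma norm_matrix_vector_mult_le:
  fixes M :: "real^'n::finite^'m::finite"
  shows "norm (M *v h) \<le> norm M * norm h"
proof -
  have "norm (M *v h) = L2_set (\<lambda>i. \<bar>M $ i \<bullet> h\<bar>) UNIV"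
    by (simp add: norm_vec_def matrix_vector_mul_component)
  also have "\<dots> \<le> L2_set (\<lambda>i. norm (M $ i) * norm h) UNIV"
    by (intro L2_set_mono Cauchy_Schwarz_ineq2) simp
  also have "\<dots> = norm M * norm h"
    by (simp add: norm_vec_def[of M] L2_set_left_distrib)
  finally show ?thesis .
qed

lemma second_order_mean_value:
  fixes f :: "'v::real_inner \<Rightarrow> real"
  assumes segment: "\<And>s. 0 \<le> s \<Longrightarrow> s \<le> 1 \<Longrightarrow> p + s *\<^sub>R h \<in> U"
    and D: "\<And>q. q \<in> U \<Longrightarrow> (f has_derivative (\<lambda>h. D q \<bullet> h)) (at q)"
    and H: "\<And>q. q \<in> U \<Longrightarrow> (D has_derivative H q) (at q)"
  obtains t where "0 < t" "t < 1" "f (p + h) = f p + D p \<bullet> h + (H (p + t *\<^sub>R h) h \<bullet> h) / 2"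
proof -
  define \<phi> where "\<phi> m s = (let q = p + s *\<^sub>R h in [f q, D q \<bullet> h, H q h \<bullet> h] ! m)"
    for m :: nat and s :: real
  have line: "((\<lambda>s. p + s *\<^sub>R h) has_derivative (\<lambda>s. s *\<^sub>R h)) (at s)" for s :: real
    by (auto intro!: derivative_eq_intros)
  have "DERIV (\<phi> m) s :> \<phi> (Suc m) s" if m: "m < 2" and s: "0 \<le> s" "s \<le> 1" for m s
  proof -
    let ?q = "p + s *\<^sub>R h"
    have H_scaleR: "H ?q (c *\<^sub>R h) = c *\<^sub>R H ?q h" for c
      by (rule linear_scale[OF has_derivative_linear[OF H[OF segment[OF s]]]])
    from m consider "m = 0" | "m = 1" by linarith
    thus ?thesis
    proof cases
      case 1
      thus ?thesis
        using has_derivative_compose[OF line D[OF segment[OF s]]]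
        by (simp add: \<phi>_def[abs_def] has_field_derivative_def mult.commute[of _ "_ \<bullet> _"])
    next
      case 2
      thus ?thesis
        using has_derivative_inner_left[OF has_derivative_compose[OF line H[OF segment[OF s]]],
          of h]
        by (simp add: \<phi>_def[abs_def] has_field_derivative_def H_scaleR mult.commute[of _ "_ \<bullet> _"])
    qed
  qed
  hence "\<exists>t>0. t < 1 \<and> \<phi> 0 1 = (\<Sum>m<2. \<phi> m 0 / fact m * 1 ^ m) + \<phi> 2 t / fact 2 * 1 ^ 2"
    by (intro Maclaurin) auto
  thus ?thesis
    using that by (auto simp: \<phi>_def eval_nat_numeral)
qed

lemma second_order_taylor:
  fixes f :: "real^'a::finite \<Rightarrow> real" and D :: "real^'a \<Rightarrow> real^'a" and H :: "real^'a \<Rightarrow> real^'a^'a"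
  assumes U: "open U" "p \<in> U"
    and D: "\<And>q. q \<in> U \<Longrightarrow> (f has_derivative (\<lambda>h. D q \<bullet> h)) (at q)"
    and H: "\<And>q. q \<in> U \<Longrightarrow> (D has_derivative (*v) (H q)) (at q)"
    and cont: "isCont H p"
  shows "\<exists>\<delta>>0. \<forall>h. norm h < \<delta> \<longrightarrow>
    \<bar>f (p + h) - f p - D p \<bullet> h\<bar> \<le> (onorm ((*v) (H p)) + 1) / 2 * (norm h)\<^sup>2"
proof -
  obtain \<delta>1 where \<delta>1: "\<delta>1 > 0" "ball p \<delta>1 \<subseteq> U"
    using U open_contains_ball by blast
  obtain \<delta>2 where \<delta>2: "\<delta>2 > 0" "\<And>q. dist q p < \<delta>2 \<Longrightarrow> dist (H q) (H p) < 1"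
    using cont unfolding continuous_at_eps_delta by (metis zero_less_one)
  have "\<bar>f (p + h) - f p - D p \<bullet> h\<bar> \<le> (onorm ((*v) (H p)) + 1) / 2 * (norm h)\<^sup>2"
    if h: "norm h < min \<delta>1 \<delta>2" for h
  proof -
    have near: "dist (p + s *\<^sub>R h) p < min \<delta>1 \<delta>2" if "0 \<le> s" "s \<le> 1" for s
      using h that mult_left_le_one_le[of "norm h" s] by (simp add: dist_norm)
    hence "p + s *\<^sub>R h \<in> U" if "0 \<le> s" "s \<le> 1" for s
      using that \<delta>1(2) by (auto simp: dist_commute subset_iff)
    then obtain t where t: "0 < t" "t < 1"
      "f (p + h) = f p + D p \<bullet> h + ((H (p + t *\<^sub>R h) *v h) \<bullet> h) / 2"
      using second_order_mean_value[OF _ D H] by blast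
    define q where "q = p + t *\<^sub>R h"
    have "norm (H q *v h) \<le> norm (H p *v h) + norm ((H q - H p) *v h)"
      using norm_triangle_ineq[of "H p *v h" "(H q - H p) *v h"]
      by (simp add: matrix_vector_mult_diff_rdistrib)
    also have "norm (H p *v h) \<le> onorm ((*v) (H p)) * norm h"
      by (rule onorm[OF matrix_vector_mul_bounded_linear])
    also have "norm ((H q - H p) *v h) \<le> norm (H q - H p) * norm h"
      by (rule norm_matrix_vector_mult_le)
    also have "\<dots> \<le> 1 * norm h"
      using \<delta>2(2)[of q] near[of t] t by (intro mult_right_mono) (auto simp: q_def dist_norm)
    finally have "norm (H q *v h) \<le> (onorm ((*v) (H p)) + 1) * norm h"
      by (simp add: distrib_right)
    hence "norm (H q *v h) * norm h \<le> (onorm ((*v) (H p)) + 1) * norm h * norm h"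
      by (rule mult_right_mono) simp
    moreover have "\<bar>(H q *v h) \<bullet> h\<bar> \<le> norm (H q *v h) * norm h"
      by (rule Cauchy_Schwarz_ineq2)
    ultimately show ?thesis
      by (simp add: t(3) q_def power2_eq_square)
  qed
  thus ?thesis using \<delta>1 \<delta>2 by (intro exI[of _ "min \<delta>1 \<delta>2"]) auto
qed

lemma second_order_taylor_vec_lower:
  fixes g :: "real^'a::finite \<Rightarrow> real^'d::finite" and Dg :: "'d \<Rightarrow> real^'a \<Rightarrow> real^'a"
    and Hg :: "'d \<Rightarrow> real^'a \<Rightarrow> real^'a^'a"
  assumes U: "open U" "p \<in> U"
    and Dg: "\<And>t q. q \<in> U \<Longrightarrow> ((\<lambda>q. g q $ t) has_derivative (\<lambda>h. Dg t q \<bullet> h)) (at q)"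
    and Hg: "\<And>t q. q \<in> U \<Longrightarrow> (Dg t has_derivative (*v) (Hg t q)) (at q)"
    and cont: "\<And>t. isCont (Hg t) p"
  shows "\<exists>\<delta>>0. \<forall>h. norm h < \<delta> \<longrightarrow>
    (\<forall>t. g p $ t + Dg t p \<bullet> h - ((MAX t. onorm ((*v) (Hg t p))) + 1) / 2 * (norm h)\<^sup>2 \<le>
      g (p + h) $ t)"
proof -
  define \<kappa> where "\<kappa> = (MAX t. onorm ((*v) (Hg t p)))"
  have "\<exists>\<delta>>0. \<forall>h. norm h < \<delta> \<longrightarrow> \<bar>g (p + h) $ t - g p $ t - Dg t p \<bullet> h\<bar> \<le>
      (onorm ((*v) (Hg t p)) + 1) / 2 * (norm h)\<^sup>2" for t
    by (rule second_order_taylor[OF U Dg Hg cont])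
  then obtain \<delta> where \<delta>: "\<And>t. \<delta> t > 0" "\<And>t h. norm h < \<delta> t \<Longrightarrow>
      \<bar>g (p + h) $ t - g p $ t - Dg t p \<bullet> h\<bar> \<le> (onorm ((*v) (Hg t p)) + 1) / 2 * (norm h)\<^sup>2"
    by metis
  have "g p $ t + Dg t p \<bullet> h - (\<kappa> + 1) / 2 * (norm h)\<^sup>2 \<le> g (p + h) $ t"
    if h: "norm h < Min (range \<delta>)" for t h
  proof -
    have "onorm ((*v) (Hg t p)) \<le> \<kappa>"
      unfolding \<kappa>_def by (rule Max_ge) auto
    hence "(onorm ((*v) (Hg t p)) + 1) / 2 * (norm h)\<^sup>2 \<le> (\<kappa> + 1) / 2 * (norm h)\<^sup>2"
      by (intro mult_right_mono) auto
    moreover have "norm h < \<delta> t" using h by simp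
    ultimately show ?thesis using \<delta>(2)[of h t] by linarith
  qed
  moreover have "Min (range \<delta>) > 0" using \<delta>(1) by simp
  ultimately show ?thesis unfolding \<kappa>_def by blast
qed

section \<open>Smooth functions of types\<close>

lemma gauss_upper_prob_eq_measure:
  fixes V :: "real^'d::finite^'d"
  assumes "\<exists>A :: real^'d^'d. A ** transpose A = V"
  shows "\<exists>A :: real^'d^'d. A ** transpose A = V \<and>
    (\<forall>z. gauss_upper_prob V z = measure gauss_measure {w. z \<le> A *v w})"
proof (intro exI conjI allI)
  define A where "A = (SOME A :: real^'d^'d. A ** transpose A = V)"
  show "A ** transpose A = V"
    unfolding A_def using assms by (rule someI_ex)
  show "gauss_upper_prob V z = measure gauss_measure {w. z \<le> A *v w}" for z
    using measure_std_gauss_eq_gauss_measure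
      [OF borel_closed[OF closed_upper_orthant_preimage[of z A]]]
    by (simp add: gauss_upper_prob_def A_def)
qed

lemma berry_esseen_linear_type:
  fixes p :: "real^'a::finite" and J :: "real^'a^'d::finite"
  assumes p: "p \<in> prob_simplex"
  defines "V \<equiv> \<Sum>x\<in>UNIV. p $ x *\<^sub>R outer (J *v (axis x 1 - p))"
  shows "\<exists>C. \<forall>n>0. \<forall>z.
    \<bar>measure_pmf.prob (walk_pmf (centred_letter_pmf p) n) {S. sqrt (real n) *\<^sub>R z \<le> J *v S}
      - gauss_upper_prob V z\<bar> \<le> C * (1 + ln (real n)) / sqrt (real n)"
proof -
  let ?P = "map_pmf ((*v) J) (centred_letter_pmf p)"
  have "\<exists>A :: real^'d^'d. A ** transpose A = V"
    unfolding V_def using p by (intro covariance_factorization) (simp add: prob_simplex_def)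
  then obtain A :: "real^'d^'d" where A: "A ** transpose A = V"
    "\<And>z. gauss_upper_prob V z = measure gauss_measure {w. z \<le> A *v w}"
    using gauss_upper_prob_eq_measure by blast
  have "measure_pmf.expectation ?P (\<lambda>y. c \<bullet> y) = 0" for c
    using expectation_inner_centred_letter_pmf[OF p, of "c v* J"] by (simp add: dot_lmul_matrix)
  moreover have "measure_pmf.expectation ?P (\<lambda>y. (c \<bullet> y)\<^sup>2) = (norm (c v* A))\<^sup>2" for c
    using covariance_quadratic_form[OF A(1)[unfolded V_def], of c]
    by (simp add: expectation_centred_letter_pmf[OF p])
  ultimately have "\<exists>C. \<forall>n>0. \<forall>z.
      \<bar>measure_pmf.prob (walk_pmf ?P n) {u. sqrt (real n) *\<^sub>R z \<le> u}
        - measure gauss_measure {w. z \<le> A *v w}\<bar> \<le> C * (1 + ln (real n)) / sqrt (real n)"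
    by (intro berry_esseen_upper_orthant) (simp_all add: finite_set_centred_letter_pmf)
  thus ?thesis
    by (simp add: A(2) vimage_def flip: map_walk_pmf[OF matrix_vector_mul_linear])
qed

lemma taylor_event:
  fixes g :: "real^'a::finite \<Rightarrow> real^'d::finite" and J :: "real^'a^'d"
  assumes taylor: "\<And>h t. norm h < \<delta> \<Longrightarrow> g p $ t + (J *v h) $ t - b / 2 * (norm h)\<^sup>2 \<le> g (p + h) $ t"
    and b: "b \<ge> 0" and \<delta>: "\<delta> > 0" "2 * s / real n < \<delta>\<^sup>2" and n: "n > 0"
    and S: "sqrt (real n) *\<^sub>R z \<le> J *v S" "(norm S)\<^sup>2 \<le> 2 * real n * s"
  shows "g p + (1 / sqrt (real n)) *\<^sub>R z - (b * s / real n) *\<^sub>R (\<chi> t. 1) \<le> g (p + S /\<^sub>R real n)"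
proof -
  define h where "h = S /\<^sub>R real n"
  have "(norm h)\<^sup>2 = (norm S)\<^sup>2 / (real n)\<^sup>2"
    by (simp add: h_def power_mult_distrib power_inverse field_simps)
  also have "\<dots> \<le> 2 * real n * s / (real n)\<^sup>2"
    using S(2) by (intro divide_right_mono) auto
  also have "\<dots> = 2 * s / real n"
    using n by (simp add: power2_eq_square)
  finally have h: "(norm h)\<^sup>2 \<le> 2 * s / real n" .
  hence "norm h < \<delta>"
    using \<delta> by (intro power_less_imp_less_base[of "norm h" 2 \<delta>]) auto
  have "z $ t / sqrt (real n) - b * s / real n \<le> (J *v h) $ t - b / 2 * (norm h)\<^sup>2" for t
  proof (rule diff_mono)
    have "z $ t / sqrt (real n) = sqrt (real n) * z $ t / real n"
      using n by (simp add: field_simps)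
    also have "\<dots> \<le> (J *v S) $ t / real n"
      using S(1) by (intro divide_right_mono) (auto simp: less_eq_vec_def)
    also have "\<dots> = (J *v h) $ t"
      by (simp add: h_def matrix_vector_mult_scaleR divide_inverse mult.commute)
    finally show "z $ t / sqrt (real n) \<le> (J *v h) $ t" .
    have "b / 2 * (norm h)\<^sup>2 \<le> b / 2 * (2 * s / real n)"
      using h b by (intro mult_left_mono) auto
    thus "b / 2 * (norm h)\<^sup>2 \<le> b * s / real n" by simp
  qed
  hence "g p $ t + z $ t / sqrt (real n) - b * s / real n \<le> g (p + h) $ t" for t
    using taylor[OF \<open>norm h < \<delta>\<close>, of t] by (smt (verit))
  thus ?thesis by (simp add: less_eq_vec_def h_def)
qed

lemma prob_type_function_ge:
  fixes g :: "real^'a::finite \<Rightarrow> real^'d::finite" and J :: "real^'a^'d"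
  assumes p: "p \<in> prob_simplex"
    and taylor: "\<And>h t. norm h < \<delta> \<Longrightarrow> g p $ t + (J *v h) $ t - b / 2 * (norm h)\<^sup>2 \<le> g (p + h) $ t"
    and b: "b \<ge> 0" and \<delta>: "\<delta> > 0" "2 * s / real n < \<delta>\<^sup>2" and n: "n > 0"
  shows "measure_pmf.prob (walk_pmf (centred_letter_pmf p) n) {S. sqrt (real n) *\<^sub>R z \<le> J *v S}
      - measure_pmf.prob (walk_pmf (centred_letter_pmf p) n) {S. (norm S)\<^sup>2 > 2 * real n * s} \<le>
    iid_prob p n (\<lambda>xs.
      g p + (1 / sqrt (real n)) *\<^sub>R z - (b * s / real n) *\<^sub>R (\<chi> t. 1) \<le> g (type_of xs))"
proof -
  let ?W = "walk_pmf (centred_letter_pmf p) n"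
  let ?large = "{S. (norm S)\<^sup>2 > 2 * real n * s}"
  let ?target = "{S. g p + (1 / sqrt (real n)) *\<^sub>R z - (b * s / real n) *\<^sub>R (\<chi> t. 1) \<le>
    g (p + S /\<^sub>R real n)}"
  have "measure_pmf.prob ?W {S. sqrt (real n) *\<^sub>R z \<le> J *v S} \<le>
      measure_pmf.prob ?W (?target \<union> ?large)"
    using taylor_event[of \<delta> g p J b, OF taylor b \<delta> n]
    by (intro measure_pmf.finite_measure_mono) (auto simp: not_less)
  also have "\<dots> \<le> measure_pmf.prob ?W ?target + measure_pmf.prob ?W ?large"
    by (intro measure_subadditive) auto
  finally show ?thesis
    unfolding iid_prob_type_eq_prob_walk[OF p n,
        of "\<lambda>q. g p + (1 / sqrt (real n)) *\<^sub>R z - (b * s / real n) *\<^sub>R (\<chi> t. 1) \<le> g q"]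
    by linarith
qed

lemma eventually_le_imp_ex_le:
  fixes f r :: "nat \<Rightarrow> real"
  assumes "\<forall>\<^sub>F n in sequentially. f n \<le> C * r n" and r: "\<And>n. n \<ge> k \<Longrightarrow> r n > 0"
  shows "\<exists>C. \<forall>n\<ge>k. f n \<le> C * r n"
proof -
  obtain N where N: "\<And>n. n \<ge> N \<Longrightarrow> f n \<le> C * r n"
    using assms(1) by (auto simp: eventually_sequentially)
  define C' where "C' = \<bar>C\<bar> + (\<Sum>n<N. \<bar>f n / r n\<bar>)"
  have "f n \<le> C' * r n" if n: "n \<ge> k" for n
  proof -
    have "f n / r n \<le> C'"
    proof (cases "n < N")
      case True
      hence "\<bar>f n / r n\<bar> \<le> (\<Sum>n<N. \<bar>f n / r n\<bar>)"
        by (intro member_le_sum[of n "{..<N}" "\<lambda>n. \<bar>f n / r n\<bar>"]) auto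
      thus ?thesis unfolding C'_def by linarith
    next
      case False
      hence "f n / r n \<le> C" using N[of n] r[OF n] by (simp add: divide_le_eq)
      also have "\<dots> \<le> C'"
        unfolding C'_def by (rule order_trans[OF abs_ge_self]) (simp add: sum_nonneg)
      finally show ?thesis .
    qed
    thus ?thesis using r[OF n] by (simp add: divide_le_eq)
  qed
  thus ?thesis by blast
qed

lemma one_plus_ln_le_log2:
  assumes "n \<ge> 2"
  shows "1 + ln (real n) \<le> 2 * log 2 (real n)"
proof -
  have "ln (real n) \<le> log 2 (real n)"
    using assms ln_2_less_1 by (simp add: log_def le_divide_eq mult_left_le)
  moreover have "1 \<le> log 2 (real n)" using assms by simp
  ultimately show ?thesis by linarith
qed

lemma eventually_two_log2_div_less:
  fixes c :: real
  assumes "c > 0"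
  shows "\<forall>\<^sub>F n in sequentially. 2 * log 2 (real n) / real n < c"
proof -
  have "(\<lambda>n. 2 / ln 2 * (ln (real n) / real n)) \<longlonglongrightarrow> 2 / ln 2 * 0"
    by (intro tendsto_intros lim_ln_over_n)
  from order_tendstoD(2)[OF this, of c] show ?thesis
    using assms by (simp add: log_def)
qed

theorem type_function_central_limit_lower:
  fixes g :: "real^'a::finite \<Rightarrow> real^'d::finite" and J :: "real^'a^'d"
  assumes p: "p \<in> prob_simplex"
    and taylor: "\<And>h t. norm h < \<delta> \<Longrightarrow> g p $ t + (J *v h) $ t - b / 2 * (norm h)\<^sup>2 \<le> g (p + h) $ t"
    and b: "b \<ge> 0" and \<delta>: "\<delta> > 0"
  shows "\<exists>C. \<forall>n\<ge>2.
    gauss_upper_prob (\<Sum>x\<in>UNIV. p $ x *\<^sub>R outer (J *v (axis x 1 - p))) z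
      - C * log 2 (real n) / sqrt (real n) \<le>
    iid_prob p n (\<lambda>xs. g p + (1 / sqrt (real n)) *\<^sub>R z
      - (b * log 2 (real n) / real n) *\<^sub>R (\<chi> t. 1) \<le> g (type_of xs))"
proof -
  define \<Gamma> where "\<Gamma> = gauss_upper_prob (\<Sum>x\<in>UNIV. p $ x *\<^sub>R outer (J *v (axis x 1 - p))) z"
  define \<Theta> where "\<Theta> n = iid_prob p n (\<lambda>xs. g p + (1 / sqrt (real n)) *\<^sub>R z
    - (b * log 2 (real n) / real n) *\<^sub>R (\<chi> t. 1) \<le> g (type_of xs))" for n
  define linear_prob where "linear_prob n =
    measure_pmf.prob (walk_pmf (centred_letter_pmf p) n) {S. sqrt (real n) *\<^sub>R z \<le> J *v S}" for n
  define deviation_prob where "deviation_prob n =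
    measure_pmf.prob (walk_pmf (centred_letter_pmf p) n)
      {S. (norm S)\<^sup>2 > 2 * real n * log 2 (real n)}" for n
  obtain C where C: "\<And>n. n > 0 \<Longrightarrow> \<bar>linear_prob n - \<Gamma>\<bar> \<le> C * (1 + ln (real n)) / sqrt (real n)"
    using berry_esseen_linear_type[OF p, of J] unfolding linear_prob_def \<Gamma>_def by blast
  obtain K where K: "K \<ge> 0" "\<And>n. n > 0 \<Longrightarrow> deviation_prob n \<le> K / sqrt (real n)"
    using type_concentration[OF p] unfolding deviation_prob_def by blast
  have "\<forall>\<^sub>F n in sequentially. 2 * log 2 (real n) / real n < \<delta>\<^sup>2"
    using \<delta> by (intro eventually_two_log2_div_less) simp
  moreover have "\<forall>\<^sub>F n in sequentially. n \<ge> 2"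
    by (rule eventually_ge_at_top)
  ultimately have "\<forall>\<^sub>F n in sequentially.
      \<Gamma> - \<Theta> n \<le> (2 * \<bar>C\<bar> + K) * (log 2 (real n) / sqrt (real n))"
  proof eventually_elim
    case (elim n)
    have "linear_prob n - deviation_prob n \<le> \<Theta> n"
      unfolding linear_prob_def deviation_prob_def \<Theta>_def
      using prob_type_function_ge[OF p taylor b \<delta> elim(1)] elim(2) by simp
    hence "\<Gamma> - \<Theta> n \<le> C * (1 + ln (real n)) / sqrt (real n) + K / sqrt (real n)"
      using C[of n] K(2)[of n] elim(2) by (simp add: abs_le_iff)
    also have "\<dots> = (C * (1 + ln (real n)) + K * 1) / sqrt (real n)"
      by (simp add: add_divide_distrib)
    also have "\<dots> \<le> (\<bar>C\<bar> * (2 * log 2 (real n)) + K * log 2 (real n)) / sqrt (real n)"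
      using one_plus_ln_le_log2[OF elim(2)] elim(2) K(1)
      by (intro divide_right_mono add_mono mult_mono mult_left_mono) auto
    finally show ?case by (simp add: algebra_simps)
  qed
  hence "\<exists>C. \<forall>n\<ge>2. \<Gamma> - \<Theta> n \<le> C * (log 2 (real n) / sqrt (real n))"
    by (rule eventually_le_imp_ex_le) simp
  thus ?thesis
    unfolding \<Gamma>_def[symmetric] \<Theta>_def[symmetric] by (simp add: diff_le_eq add.commute)
qed

theorem theorem6:
  fixes p :: "real^'a::finite"
    and g :: "real^'a \<Rightarrow> real^'d::finite"
    and U :: "(real^'a) set"
    and Dg :: "'d \<Rightarrow> real^'a \<Rightarrow> real^'a"
    and Hg :: "'d \<Rightarrow> real^'a \<Rightarrow> real^'a^'a"
    and z :: "real^'d"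
  assumes p_simplex: "p \<in> prob_simplex"
    and U_open: "open U" and U_simplex: "prob_simplex \<subseteq> U"
    and grad: "\<And>t q. q \<in> U \<Longrightarrow> ((\<lambda>q. g q $ t) has_derivative (\<lambda>h. Dg t q \<bullet> h)) (at q)"
    and hess: "\<And>t q. q \<in> U \<Longrightarrow> (Dg t has_derivative (\<lambda>h. Hg t q *v h)) (at q)"
    and hess_cont: "\<And>t. continuous_on U (Hg t)"
    and rank_V: "rank (\<Sum>x\<in>UNIV. p $ x *\<^sub>R outer ((\<chi> t. Dg t p $ x)
                    - (\<Sum>y\<in>UNIV. p $ y *\<^sub>R (\<chi> t. Dg t p $ y)))) \<ge> 1"
  shows "\<exists>C. \<forall>n\<ge>2.
    iid_prob p n (\<lambda>xs. g (type_of xs) \<ge>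
        g p + (1 / sqrt (real n)) *\<^sub>R z
          - (((MAX t. onorm (\<lambda>h. Hg t p *v h)) + 1) * log 2 (real n) / real n) *\<^sub>R (\<chi> t. 1))
    \<ge> gauss_upper_prob (\<Sum>x\<in>UNIV. p $ x *\<^sub>R outer ((\<chi> t. Dg t p $ x)
                    - (\<Sum>y\<in>UNIV. p $ y *\<^sub>R (\<chi> t. Dg t p $ y)))) z
      - C * log 2 (real n) / sqrt (real n)"
proof -
  define J where "J = (\<chi> t. Dg t p)"
  have J: "(J *v h) $ t = Dg t p \<bullet> h" for h t
    by (simp add: J_def matrix_vector_mul_component)
  have "(\<chi> t. Dg t p $ x) - (\<Sum>y\<in>UNIV. p $ y *\<^sub>R (\<chi> t. Dg t p $ y)) = J *v (axis x 1 - p)" for x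
    by (simp add: vec_eq_iff J inner_diff_right inner_axis) (simp add: inner_vec_def mult.commute)
  moreover obtain \<delta> where "\<delta> > 0" "\<And>h t. norm h < \<delta> \<Longrightarrow>
      g p $ t + (J *v h) $ t - ((MAX t. onorm ((*v) (Hg t p))) + 1) / 2 * (norm h)\<^sup>2 \<le>
        g (p + h) $ t"
  proof -
    have "p \<in> U" using p_simplex U_simplex by blast
    moreover have "isCont (Hg t) p" for t
      using hess_cont U_open \<open>p \<in> U\<close> by (simp add: continuous_on_eq_continuous_at)
    ultimately show ?thesis
      using second_order_taylor_vec_lower[OF U_open _ grad hess, of p] that unfolding J by blast
  qed
  moreover have "0 \<le> (MAX t. onorm ((*v) (Hg t p))) + 1"
  proof -
    have "0 \<le> onorm ((*v) (Hg undefined p))"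
      by (intro onorm_pos_le matrix_vector_mul_bounded_linear)
    also have "\<dots> \<le> (MAX t. onorm ((*v) (Hg t p)))"
      by (intro Max_ge) auto
    finally show ?thesis by simp
  qed
  ultimately show ?thesis
    using type_function_central_limit_lower[OF p_simplex,
        of \<delta> g J "(MAX t. onorm ((*v) (Hg t p))) + 1" z]
    by simp
qed

end
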